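(* Let $\mathcal H$ be an infinite dimensional Hilbert space and let $\mathcal K$ denote the Banach algebra $S_2(\mathcal H)$ of Hilbert-Schmidt operators on $\mathcal H$ (with composition as multiplication), which is also a Hilbert space. Then the Banach algebra $B_0(\mathcal K)\otimes^\gamma\mathcal K$ (the projective tensor product) is not Arens regular, where $B_0(\mathcal K)$ is the Banach algebra of compact operators on the Hilbert space $\mathcal K$.
   Context: Hilbert spaces are complex. For a Hilbert space $\mathcal H$, $S_2(\mathcal H)$ is the space of Hilbert-Schmidt operators on $\mathcal H$, a Hilbert space with inner product $\langle A,B\rangle=\operatorname{Tr}(B^*A)$, and a Banach algebra under composition of operators with the corresponding norm. $B_0(\mathcal K)$ carries the operator norm and composition. Projective tensor product: for Banach algebras $A,B$, the algebraic tensor product $A\otimes B$ has multiplication determined by $(x_1\otimes y_1)(x_2\otimes y_2)=x_1x_2\otimes y_1y_2$ and norm $\|u\|_\gamma=\inf\{\sum_{i=1}^n\|x_i\|\|y_i\| : u=\sum_{i=1}^n x_i\otimes y_i\}$; its completion is the Banach algebra $A\otimes^\gamma B$. Arens regularity: let $A$ be a normed algebra. For $a\in A$, $\omega\in A^*$, $f\in A^{**}$ define $\omega_a,{}_a\omega\in A^*$ by $\omega_a(b)=\omega(ab)$, ${}_a\omega(b)=\omega(ba)$, and $\omega_f,{}_f\omega\in A^*$ by $\omega_f(a)=f({}_a\omega)$, ${}_f\omega(a)=f(\omega_a)$. For $f,g\in A^{**}$ set $(f\Box g)(\omega)=f({}_g\omega)$ and $(f\diamond g)(\omega)=g(\omega_f)$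 for $\omega\in A^*$. $A$ is Arens regular if $f\Box g=f\diamond g$ for all $f,g\in A^{**}$. *)

theory Defs
  imports "HOL-Analysis.Analysis" "HOL-Library.Multiset"
begin

section \<open>Complex normed spaces and algebras\<close>

class complex_vector = real_vector +
  fixes scaleC :: "complex \<Rightarrow> 'a \<Rightarrow> 'a" (infixr \<open>*\<^sub>C\<close> 75)
  assumes scaleC_add_right: "a *\<^sub>C (x + y) = a *\<^sub>C x + a *\<^sub>C y"
    and scaleC_add_left: "(a + b) *\<^sub>C x = a *\<^sub>C x + b *\<^sub>C x"
    and scaleC_scaleC: "a *\<^sub>C b *\<^sub>C x = (a * b) *\<^sub>C x"
    and scaleC_of_real: "complex_of_real r *\<^sub>C x = r *\<^sub>R x"

class complex_algebra = complex_vector + real_algebra +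
  assumes mult_scaleC_left: "(a *\<^sub>C x) * y = a *\<^sub>C (x * y)"
    and mult_scaleC_right: "x * (a *\<^sub>C y) = a *\<^sub>C (x * y)"

class complex_normed_vector = complex_vector + real_normed_vector +
  assumes norm_scaleC: "norm (a *\<^sub>C x) = cmod a * norm x"

class complex_banach = complex_normed_vector + complete_space

class complex_normed_algebra = complex_algebra + complex_normed_vector + real_normed_algebra

class complex_banach_algebra = complex_normed_algebra + complex_banach

subclass (in complex_banach) banach ..

instantiation complex :: complex_banach_algebra
begin
definition scaleC_complex :: "complex \<Rightarrow> complex \<Rightarrow> complex"
  where "scaleC_complex a x = a * x"
instance
  by standard (auto simp: scaleC_complex_def algebra_simps norm_mult scaleR_conv_of_real)
end

lemma scaleC_one [simp]: "1 *\<^sub>C x = (x :: 'a::complex_vector)"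
  using scaleC_of_real[of 1 x] by simp

lemma scaleC_zero_left [simp]: "0 *\<^sub>C x = (0 :: 'a::complex_vector)"
  using scaleC_of_real[of 0 x] by simp

lemma scaleC_zero_right [simp]: "a *\<^sub>C 0 = (0 :: 'a::complex_vector)"
  using scaleC_add_right[of a 0 0] by simp

lemma scaleC_minus1: "(-1) *\<^sub>C x = - (x :: 'a::complex_vector)"
  using scaleC_of_real[of "-1" x] by simp

lemma scaleC_minus_right: "a *\<^sub>C (- x) = - (a *\<^sub>C (x :: 'a::complex_vector))"
  using scaleC_add_right[of a x "-x"] by (simp add: eq_neg_iff_add_eq_0 add.commute)

lemma scaleC_diff_right: "a *\<^sub>C (x - y) = a *\<^sub>C x - a *\<^sub>C (y :: 'a::complex_vector)"
  using scaleC_add_right[of a x "-y"] by (simp add: scaleC_minus_right)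

lemma bounded_linear_scaleC: "bounded_linear (\<lambda>x :: 'a::complex_normed_vector. a *\<^sub>C x)"
  by (rule bounded_linear_intro[where K = "cmod a"])
    (auto simp: scaleC_add_right norm_scaleC scaleC_scaleC mult.commute simp flip: scaleC_of_real)

definition bounded_clinear :: "('a::complex_normed_vector \<Rightarrow> 'b::complex_normed_vector) \<Rightarrow> bool"
  where "bounded_clinear f \<longleftrightarrow> bounded_linear f \<and> (\<forall>c x. f (c *\<^sub>C x) = c *\<^sub>C f x)"

lemma bounded_clinear_bounded_linear: "bounded_clinear f \<Longrightarrow> bounded_linear f"
  by (simp add: bounded_clinear_def)

lemma bounded_clinear_scaleC: "bounded_clinear f \<Longrightarrow> f (c *\<^sub>C x) = c *\<^sub>C f x"
  by (simp add: bounded_clinear_def)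

lemma bounded_clinear_add: "bounded_clinear f \<Longrightarrow> f (x + y) = f x + f y"
  by (simp add: bounded_clinear_def linear_simps)

lemma bounded_clinear_zero: "bounded_clinear f \<Longrightarrow> f 0 = 0"
  by (simp add: bounded_clinear_def linear_simps)

lemma bounded_clinear_sum: "bounded_clinear f \<Longrightarrow> f (sum g S) = (\<Sum>x\<in>S. f (g x))"
  by (simp add: bounded_clinear_def bounded_linear.linear linear_sum)

lemma bounded_clinearI:
  assumes "\<And>x y. f (x + y) = f x + f y" "\<And>c x. f (c *\<^sub>C x) = c *\<^sub>C f x"
    and "\<And>x. norm (f x) \<le> norm x * K"
  shows "bounded_clinear f"
  unfolding bounded_clinear_def
proof (intro conjI allI bounded_linear_intro)
  show "f (r *\<^sub>R x) = r *\<^sub>R f x" for r x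
    using assms(2)[of "complex_of_real r" x] by (simp add: scaleC_of_real)
qed (use assms in auto)

lemma bounded_clinear_const_zero: "bounded_clinear (\<lambda>x. 0)"
  by (rule bounded_clinearI[where K = 0]) auto

lemma bounded_clinear_plus:
  "bounded_clinear f \<Longrightarrow> bounded_clinear g \<Longrightarrow> bounded_clinear (\<lambda>x. f x + g x)"
  by (auto simp: bounded_clinear_def bounded_linear_add scaleC_add_right)

lemma bounded_clinear_scale: "bounded_clinear f \<Longrightarrow> bounded_clinear (\<lambda>x. a *\<^sub>C f x)"
  by (auto simp: bounded_clinear_def scaleC_scaleC mult.commute
      intro: bounded_linear_compose[OF bounded_linear_scaleC])

lemma bounded_clinear_minus: "bounded_clinear f \<Longrightarrow> bounded_clinear (\<lambda>x. - f x)"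
  by (auto simp: bounded_clinear_def bounded_linear_minus scaleC_minus_right)

lemma bounded_clinear_diff:
  "bounded_clinear f \<Longrightarrow> bounded_clinear g \<Longrightarrow> bounded_clinear (\<lambda>x. f x - g x)"
  by (auto simp: bounded_clinear_def bounded_linear_sub scaleC_diff_right)

lemma bounded_clinear_compose:
  "bounded_clinear f \<Longrightarrow> bounded_clinear g \<Longrightarrow> bounded_clinear (\<lambda>x. f (g x))"
  by (auto simp: bounded_clinear_def intro: bounded_linear_compose)

lemma bounded_clinear_lim:
  assumes lin: "\<And>n. bounded_clinear (F n)" and lim: "\<And>x. (\<lambda>n. F n x) \<longlonglongrightarrow> f x"
    and bd: "\<And>n x. norm (F n x) \<le> norm x * K"
  shows "bounded_clinear f"
proof (rule bounded_clinearI)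
  show "f (x + y) = f x + f y" for x y
    using LIMSEQ_unique[OF lim[of "x + y"]] tendsto_add[OF lim[of x] lim[of y]]
    by (simp add: bounded_clinear_add[OF lin])
  show "f (c *\<^sub>C x) = c *\<^sub>C f x" for c x
    using LIMSEQ_unique[OF lim[of "c *\<^sub>C x"]] bounded_linear.tendsto[OF bounded_linear_scaleC lim[of x]]
    by (simp add: bounded_clinear_scaleC[OF lin])
  show "norm (f x) \<le> norm x * K" for x
    by (rule tendsto_upperbound[OF tendsto_norm[OF lim]]) (auto simp: bd)
qed


section \<open>Hilbert spaces and orthonormal bases\<close>

class complex_inner = complex_normed_vector +
  fixes cinner :: "'a \<Rightarrow> 'a \<Rightarrow> complex"
  assumes cinner_add_left: "cinner (x + y) z = cinner x z + cinner y z"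
    and cinner_scaleC_left: "cinner (a *\<^sub>C x) y = a * cinner x y"
    and cinner_commute: "cinner x y = cnj (cinner y x)"
    and cinner_norm: "cinner x x = complex_of_real ((norm x)\<^sup>2)"

class chilbert_space = complex_inner + complex_banach

lemma cinner_add_right: "cinner x (y + z) = cinner x y + cinner x (z :: 'a::complex_inner)"
  by (metis cinner_add_left cinner_commute complex_cnj_add)

lemma cinner_scaleC_right: "cinner x (a *\<^sub>C y) = cnj a * cinner x (y :: 'a::complex_inner)"
  by (metis cinner_scaleC_left cinner_commute complex_cnj_mult)

lemma cinner_zero_left [simp]: "cinner 0 (x :: 'a::complex_inner) = 0"
  using cinner_add_left[of 0 0 x] by simp

lemma cinner_zero_right [simp]: "cinner (x :: 'a::complex_inner) 0 = 0"
  using cinner_add_right[of x 0 0] by simp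

lemma cinner_diff_left: "cinner (x - y) z = cinner x z - cinner y (z :: 'a::complex_inner)"
  using cinner_add_left[of "x - y" y z] by simp

lemma cinner_diff_right: "cinner z (x - y) = cinner z x - cinner z (y :: 'a::complex_inner)"
  using cinner_add_right[of z "x - y" y] by simp

lemma cinner_sum_left: "cinner (sum f S) (y :: 'a::complex_inner) = (\<Sum>i\<in>S. cinner (f i) y)"
  by (induction S rule: infinite_finite_induct) (auto simp: cinner_add_left)

lemma cinner_sum_right: "cinner (y :: 'a::complex_inner) (sum f S) = (\<Sum>i\<in>S. cinner y (f i))"
  by (induction S rule: infinite_finite_induct) (auto simp: cinner_add_right)

definition orthonormal :: "'a::complex_inner set \<Rightarrow> bool"
  where "orthonormal E \<longleftrightarrow> (\<forall>e\<in>E. \<forall>f\<in>E. cinner e f = (if e = f then 1 else 0))"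

text \<open>In a Hilbert space, an orthonormal set is a basis iff only \<open>0\<close> is orthogonal to it.\<close>
definition orthonormal_basis :: "'a::complex_inner set \<Rightarrow> bool"
  where "orthonormal_basis E \<longleftrightarrow>
    orthonormal E \<and> (\<forall>x. (\<forall>e\<in>E. cinner x e = 0) \<longrightarrow> x = 0)"

lemma orthonormal_subset: "orthonormal E \<Longrightarrow> F \<subseteq> E \<Longrightarrow> orthonormal F"
  unfolding orthonormal_def by blast

lemma orthonormal_norm: "orthonormal E \<Longrightarrow> e \<in> E \<Longrightarrow> norm e = 1"
proof -
  assume "orthonormal E" "e \<in> E"
  then have "complex_of_real ((norm e)\<^sup>2) = 1"
    unfolding cinner_norm[symmetric] orthonormal_def by simp
  then have "(norm e)\<^sup>2 = 1"
    using of_real_eq_1_iff by blast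
  then show ?thesis
    using norm_ge_zero[of e] by (smt (verit) power2_eq_1_iff)
qed

lemma pythagoras:
  assumes "orthonormal E" "finite E"
  shows "(norm (\<Sum>e\<in>E. c e *\<^sub>C e))\<^sup>2 = (\<Sum>e\<in>E. (cmod (c e))\<^sup>2)"
proof -
  have "complex_of_real ((norm (\<Sum>e\<in>E. c e *\<^sub>C e))\<^sup>2) = (\<Sum>e\<in>E. \<Sum>f\<in>E. c e * (cnj (c f) * cinner e f))"
    unfolding cinner_norm[symmetric] cinner_sum_left cinner_scaleC_left
    unfolding cinner_sum_right cinner_scaleC_right sum_distrib_left ..
  also have "\<dots> = (\<Sum>e\<in>E. \<Sum>f\<in>E. if e = f then c e * cnj (c e) else 0)"
    using assms by (intro sum.cong) (auto simp: orthonormal_def)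
  also have "\<dots> = (\<Sum>e\<in>E. complex_of_real ((cmod (c e))\<^sup>2))"
    using assms by (simp add: complex_norm_square del: of_real_power)
  finally show ?thesis
    unfolding of_real_sum[symmetric] of_real_eq_iff .
qed

lemma bessel_eq:
  assumes "orthonormal E" "finite E"
  shows "(norm (x - (\<Sum>e\<in>E. cinner x e *\<^sub>C e)))\<^sup>2 = (norm x)\<^sup>2 - (\<Sum>e\<in>E. (cmod (cinner x e))\<^sup>2)"
proof -
  define p where "p = (\<Sum>e\<in>E. cinner x e *\<^sub>C e)"
  define S where "S = (\<Sum>e\<in>E. (cmod (cinner x e))\<^sup>2)"
  have xp: "cinner x p = of_real S"
    by (simp add: p_def S_def cinner_sum_right cinner_scaleC_right complex_norm_square mult.commute
        del: of_real_power)
  then have px: "cinner p x = of_real S"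
    by (metis cinner_commute complex_cnj_complex_of_real)
  have pp: "cinner p p = of_real S"
    by (simp add: cinner_norm pythagoras[OF assms] p_def S_def)
  have "complex_of_real ((norm (x - p))\<^sup>2) = of_real ((norm x)\<^sup>2 - S)"
    unfolding cinner_norm[symmetric] cinner_diff_left cinner_diff_right xp px pp
    by (simp add: cinner_norm)
  then show ?thesis
    unfolding p_def S_def of_real_eq_iff .
qed

lemma bessel:
  assumes "orthonormal E" "finite E"
  shows "(\<Sum>e\<in>E. (cmod (cinner x e))\<^sup>2) \<le> (norm x)\<^sup>2"
  using bessel_eq[OF assms, of x] by (smt (verit) zero_le_power2)

lemma cinner_Cauchy_Schwarz: "cmod (cinner x y) \<le> norm x * norm (y :: 'a::complex_inner)"
proof (cases "y = 0")
  case False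
  define u where "u = complex_of_real (1 / norm y) *\<^sub>C y"
  have "orthonormal {u}"
    using False by (simp add: orthonormal_def u_def cinner_norm norm_scaleC norm_divide)
  from bessel[OF this, of x] have "cmod (cinner x u) \<le> norm x"
    by simp
  moreover have "cmod (cinner x u) = cmod (cinner x y) / norm y"
    by (simp add: u_def cinner_scaleC_right norm_mult norm_divide)
  ultimately show ?thesis
    using False by (simp add: field_simps)
qed auto

lemma bounded_clinear_cinner_left: "bounded_clinear (\<lambda>x. cinner x (y :: 'a::complex_inner))"
  by (rule bounded_clinearI[where K = "norm y"])
    (auto simp: cinner_add_left cinner_scaleC_left scaleC_complex_def cinner_Cauchy_Schwarz)

lemma orthonormal_basis_exists: "\<exists>E. orthonormal_basis (E :: 'a::complex_inner set)"
proof -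
  have "\<exists>M\<in>{E. orthonormal E}. \<forall>X\<in>{E :: 'a set. orthonormal E}. M \<subseteq> X \<longrightarrow> X = M"
  proof (rule subset_Zorn_nonempty)
    have "orthonormal {}"
      by (simp add: orthonormal_def)
    then show "{E :: 'a set. orthonormal E} \<noteq> {}"
      by blast
    fix C :: "'a set set"
    assume "C \<noteq> {}" and C: "subset.chain {E. orthonormal E} C"
    show "\<Union> C \<in> {E. orthonormal E}"
      unfolding orthonormal_def mem_Collect_eq
    proof (intro ballI)
      fix e f assume "e \<in> \<Union> C" "f \<in> \<Union> C"
      then obtain X where "X \<in> C" "e \<in> X" "f \<in> X"
        using C unfolding subset_chain_def by blast
      then show "cinner e f = (if e = f then 1 else 0)"
        using C by (auto simp: subset_chain_def orthonormal_def)
    qed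
  qed
  then obtain M :: "'a set" where M: "orthonormal M"
    and max: "\<And>X. orthonormal X \<Longrightarrow> M \<subseteq> X \<Longrightarrow> X = M"
    by auto
  have "x = 0" if x: "\<forall>e\<in>M. cinner x e = 0" for x
  proof (rule ccontr)
    assume "x \<noteq> 0"
    define u where "u = complex_of_real (1 / norm x) *\<^sub>C x"
    have uu: "cinner u u = 1"
      using \<open>x \<noteq> 0\<close> by (simp add: u_def cinner_norm norm_scaleC norm_divide)
    have ue: "cinner u e = 0" if "e \<in> M" for e
      using x that by (simp add: u_def cinner_scaleC_left)
    then have eu: "cinner e u = 0" if "e \<in> M" for e
      using that by (metis cinner_commute complex_cnj_zero)
    have "orthonormal (insert u M)"
      using M uu ue eu unfolding orthonormal_def by auto
    then have "u \<in> M"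
      using max by blast
    then show False
      using ue uu by force
  qed
  then show ?thesis
    using M by (auto simp: orthonormal_basis_def)
qed

definition some_onb :: "'a::complex_inner set"
  where "some_onb = (SOME E. orthonormal_basis E)"

lemma some_onb: "orthonormal_basis some_onb"
  unfolding some_onb_def using orthonormal_basis_exists by (rule someI_ex)

lemma orthonormal_summable:
  fixes E :: "'a::chilbert_space set"
  assumes E: "orthonormal E" and c: "(\<lambda>e. (cmod (c e))\<^sup>2) summable_on E"
  shows "(\<lambda>e. c e *\<^sub>C e) summable_on E"
proof -
  define f where "f = (\<lambda>e. c e *\<^sub>C e)"
  define g where "g = (\<lambda>e. (cmod (c e))\<^sup>2)"
  define L where "L = infsum g E"
  have L: "(sum g \<longlongrightarrow> L) (finite_subsets_at_top E)"
    using has_sum_infsum[OF c] by (simp add: g_def L_def has_sum_def)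
  have "\<exists>P. eventually P (finite_subsets_at_top E) \<and>
              (\<forall>F F'. P F \<and> P F' \<longrightarrow> dist (sum f F) (sum f F') < e)" if "e > 0" for e
  proof -
    define d where "d = (e/3)\<^sup>2"
    have "d > 0"
      using that by (simp add: d_def)
    have "\<forall>\<^sub>F F in finite_subsets_at_top E. dist (sum g F) L < d"
      using L \<open>d > 0\<close> by (simp add: tendsto_iff)
    then obtain F0 where F0: "finite F0" "F0 \<subseteq> E"
      and close: "\<And>F. finite F \<Longrightarrow> F0 \<subseteq> F \<Longrightarrow> F \<subseteq> E \<Longrightarrow> dist (sum g F) L < d"
      by (auto simp: eventually_finite_subsets_at_top)
    have gL: "sum g F \<le> L" if "finite F" "F \<subseteq> E" for F
      unfolding L_def using c that by (intro finite_sum_le_infsum) (auto simp: g_def)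
    have near: "dist (sum f F) (sum f F0) < e/2" if F: "finite F" "F0 \<subseteq> F" "F \<subseteq> E" for F
    proof -
      have "dist (sum f F) (sum f F0) = norm (sum f (F - F0))"
        using F by (simp add: dist_norm sum_diff)
      moreover have "(norm (sum f (F - F0)))\<^sup>2 = sum g (F - F0)"
        unfolding f_def g_def
        by (rule pythagoras) (use F E in \<open>auto intro: orthonormal_subset\<close>)
      moreover have "sum g (F - F0) = sum g F - sum g F0"
        using F by (simp add: sum_diff)
      moreover have "sum g F - sum g F0 < d"
        using gL[of F] close[of F0] F0 F by (auto simp: dist_real_def abs_if split: if_splits)
      ultimately have "(dist (sum f F) (sum f F0))\<^sup>2 < (e/3)\<^sup>2"
        by (simp add: d_def)
      then have "dist (sum f F) (sum f F0) < e/3"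
        using \<open>e > 0\<close> by (intro power_less_imp_less_base[of _ 2 "e/3"]) auto
      then show ?thesis
        using \<open>e > 0\<close> by simp
    qed
    have "eventually (\<lambda>F. finite F \<and> F0 \<subseteq> F \<and> F \<subseteq> E) (finite_subsets_at_top E)"
      using F0 by (auto simp: eventually_finite_subsets_at_top)
    moreover have "dist (sum f F) (sum f F') < e"
      if "finite F \<and> F0 \<subseteq> F \<and> F \<subseteq> E" "finite F' \<and> F0 \<subseteq> F' \<and> F' \<subseteq> E" for F F'
    proof -
      have "dist (sum f F) (sum f F0) < e/2" "dist (sum f F') (sum f F0) < e/2"
        using near that by blast+
      then show ?thesis
        using dist_triangle2[of "sum f F" "sum f F'" "sum f F0"] by linarith
    qed
    ultimately show ?thesis
      by (intro exI[of _ "\<lambda>F. finite F \<and> F0 \<subseteq> F \<and> F \<subseteq> E"]) blast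
  qed
  then have "cauchy_filter (filtermap (sum f) (finite_subsets_at_top E))"
    by (simp add: cauchy_filter_metric_filtermap)
  moreover have "complete (UNIV::'a set)"
    by (meson Cauchy_convergent UNIV_I complete_def convergent_def)
  ultimately obtain L' where "(sum f \<longlongrightarrow> L') (finite_subsets_at_top E)"
    using complete_uniform[where S=UNIV] by (force simp add: filterlim_def)
  then show ?thesis
    using summable_on_def has_sum_def f_def by blast
qed

lemma cinner_has_sum:
  assumes E: "orthonormal E" "e \<in> E" and s: "((\<lambda>e. c e *\<^sub>C e) has_sum x) E"
  shows "cinner x e = c e"
proof -
  have "((\<lambda>F. cinner (\<Sum>e\<in>F. c e *\<^sub>C e) e) \<longlongrightarrow> cinner x e) (finite_subsets_at_top E)"
    by (rule bounded_linear.tendsto[OF bounded_clinear_bounded_linear[OF bounded_clinear_cinner_left]])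
      (use s in \<open>simp add: has_sum_def\<close>)
  moreover have "\<forall>\<^sub>F F in finite_subsets_at_top E. cinner (\<Sum>e\<in>F. c e *\<^sub>C e) e = c e"
    unfolding eventually_finite_subsets_at_top
  proof (intro exI[of _ "{e}"] conjI allI impI)
    fix F assume F: "finite F \<and> {e} \<subseteq> F \<and> F \<subseteq> E"
    have "cinner (\<Sum>e\<in>F. c e *\<^sub>C e) e = (\<Sum>f\<in>F. if f = e then c e else 0)"
      unfolding cinner_sum_left cinner_scaleC_left
      by (rule sum.cong) (use F E in \<open>auto simp: orthonormal_def\<close>)
    then show "cinner (\<Sum>e\<in>F. c e *\<^sub>C e) e = c e"
      using F by (simp add: sum.delta)
  qed (use E(2) in simp_all)
  ultimately have "((\<lambda>F. c e) \<longlongrightarrow> cinner x e) (finite_subsets_at_top E)"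
    by (rule Lim_transform_eventually)
  then show ?thesis
    by (simp add: tendsto_const_iff)
qed

lemma onb_expansion:
  fixes x :: "'a::chilbert_space"
  assumes "orthonormal_basis E"
  shows "((\<lambda>e. cinner x e *\<^sub>C e) has_sum x) E"
proof -
  have E: "orthonormal E"
    using assms by (simp add: orthonormal_basis_def)
  have "(\<lambda>e. (cmod (cinner x e))\<^sup>2) summable_on E"
    by (rule nonneg_bdd_above_summable_on)
      (auto simp: bdd_above_def intro!: exI[of _ "(norm x)\<^sup>2"] bessel orthonormal_subset[OF E])
  from orthonormal_summable[OF E this]
  obtain y where y: "((\<lambda>e. cinner x e *\<^sub>C e) has_sum y) E"
    by (auto simp: summable_on_def)
  have "\<forall>e\<in>E. cinner (x - y) e = 0"
    using cinner_has_sum[OF E _ y] by (simp add: cinner_diff_left)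
  then have "x - y = 0"
    using assms unfolding orthonormal_basis_def by blast
  then show ?thesis
    using y by simp
qed

lemma parseval:
  fixes x :: "'a::chilbert_space"
  assumes "orthonormal_basis E"
  shows "((\<lambda>e. (cmod (cinner x e))\<^sup>2) has_sum (norm x)\<^sup>2) E"
proof -
  have E: "orthonormal E"
    using assms by (simp add: orthonormal_basis_def)
  have "((\<lambda>F. (norm (\<Sum>e\<in>F. cinner x e *\<^sub>C e))\<^sup>2) \<longlongrightarrow> (norm x)\<^sup>2) (finite_subsets_at_top E)"
    using onb_expansion[OF assms, of x] unfolding has_sum_def by (intro tendsto_intros)
  moreover have "\<forall>\<^sub>F F in finite_subsets_at_top E.
      (norm (\<Sum>e\<in>F. cinner x e *\<^sub>C e))\<^sup>2 = (\<Sum>e\<in>F. (cmod (cinner x e))\<^sup>2)"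
    by (rule eventually_finite_subsets_at_top_weakI) (use E orthonormal_subset pythagoras in blast)
  ultimately show ?thesis
    unfolding has_sum_def by (rule Lim_transform_eventually)
qed

lemma onb_norm_bound:
  fixes T :: "'a::chilbert_space \<Rightarrow> 'b::complex_normed_vector"
  assumes E: "orthonormal_basis E" and T: "bounded_clinear T"
    and N: "\<And>F. finite F \<Longrightarrow> F \<subseteq> E \<Longrightarrow> (\<Sum>e\<in>F. (norm (T e))\<^sup>2) \<le> N\<^sup>2" and "N \<ge> 0"
  shows "norm (T x) \<le> norm x * N"
proof -
  have on: "orthonormal E"
    using E by (simp add: orthonormal_basis_def)
  have "((\<lambda>F. norm (T (\<Sum>e\<in>F. cinner x e *\<^sub>C e))) \<longlongrightarrow> norm (T x)) (finite_subsets_at_top E)"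
    using onb_expansion[OF E, of x] unfolding has_sum_def
    by (intro tendsto_norm bounded_linear.tendsto[OF bounded_clinear_bounded_linear[OF T]])
  moreover have "norm (T (\<Sum>e\<in>F. cinner x e *\<^sub>C e)) \<le> norm x * N" if F: "finite F" "F \<subseteq> E" for F
  proof -
    have "norm (T (\<Sum>e\<in>F. cinner x e *\<^sub>C e)) \<le> (\<Sum>e\<in>F. cmod (cinner x e) * norm (T e))"
      unfolding bounded_clinear_sum[OF T] bounded_clinear_scaleC[OF T]
      by (rule sum_norm_le) (simp add: norm_scaleC)
    also have "\<dots> \<le> L2_set (\<lambda>e. cmod (cinner x e)) F * L2_set (\<lambda>e. norm (T e)) F"
      using L2_set_mult_ineq[of "\<lambda>e. cmod (cinner x e)" "\<lambda>e. norm (T e)" F] by simp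
    also have "\<dots> \<le> norm x * N"
    proof (rule mult_mono)
      show "L2_set (\<lambda>e. cmod (cinner x e)) F \<le> norm x"
        unfolding L2_set_def
        by (rule real_le_lsqrt) (use bessel[OF orthonormal_subset[OF on]] F in \<open>auto simp: sum_nonneg\<close>)
      show "L2_set (\<lambda>e. norm (T e)) F \<le> N"
        unfolding L2_set_def
        by (rule real_le_lsqrt) (use N[OF F] \<open>N \<ge> 0\<close> in \<open>auto simp: sum_nonneg\<close>)
    qed (auto simp: L2_set_nonneg)
    finally show ?thesis .
  qed
  ultimately show ?thesis
    by (intro tendsto_upperbound[of _ _ "finite_subsets_at_top E"])
      (auto intro: eventually_finite_subsets_at_top_weakI)
qed

lemma riesz:
  fixes f :: "'a::chilbert_space \<Rightarrow> complex"
  assumes f: "bounded_clinear f"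
  shows "\<exists>v. \<forall>x. f x = cinner x v"
proof -
  define E :: "'a set" where "E = some_onb"
  have basis: "orthonormal_basis E" and E: "orthonormal E"
    using some_onb by (auto simp: E_def orthonormal_basis_def)
  obtain K where K: "\<And>x. norm (f x) \<le> norm x * K"
    using f bounded_linear.bounded unfolding bounded_clinear_def by blast
  have bound: "(\<Sum>e\<in>F. (cmod (cnj (f e)))\<^sup>2) \<le> K\<^sup>2" if F: "finite F" "F \<subseteq> E" for F
  proof -
    define S where "S = (\<Sum>e\<in>F. (cmod (f e))\<^sup>2)"
    define w where "w = (\<Sum>e\<in>F. cnj (f e) *\<^sub>C e)"
    have "(norm w)\<^sup>2 = S"
      unfolding w_def S_def using pythagoras[OF orthonormal_subset[OF E F(2)] F(1)] by simp
    then have nw: "norm w = sqrt S"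
      using real_sqrt_unique[of "norm w" S] by simp
    have "f w = of_real S"
      unfolding w_def S_def bounded_clinear_sum[OF f] bounded_clinear_scaleC[OF f]
      by (simp add: scaleC_complex_def complex_norm_square mult.commute del: of_real_power)
    moreover have "S \<ge> 0"
      by (simp add: S_def sum_nonneg)
    ultimately have *: "S \<le> sqrt S * K"
      using K[of w] nw by simp
    have "S \<le> K\<^sup>2"
    proof (cases "S = 0")
      case False
      then have "sqrt S > 0"
        using \<open>S \<ge> 0\<close> by simp
      moreover have "sqrt S * sqrt S \<le> sqrt S * K"
        using * \<open>S \<ge> 0\<close> by simp
      ultimately have "sqrt S \<le> K"
        using \<open>sqrt S > 0\<close> mult_le_cancel_left_pos by blast
      then have "(sqrt S)\<^sup>2 \<le> K\<^sup>2"
        using \<open>sqrt S > 0\<close> by (intro power_mono) auto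
      then show ?thesis
        using \<open>S \<ge> 0\<close> by simp
    qed simp
    then show ?thesis
      by (simp add: S_def)
  qed
  have "(\<lambda>e. (cmod (cnj (f e)))\<^sup>2) summable_on E"
    by (rule nonneg_bdd_above_summable_on)
      (use bound in \<open>auto simp: bdd_above_def intro!: exI[of _ "K\<^sup>2"]\<close>)
  from orthonormal_summable[OF E this]
  obtain v where v: "((\<lambda>e. cnj (f e) *\<^sub>C e) has_sum v) E"
    by (auto simp: summable_on_def)
  define g where "g x = f x - cinner x v" for x
  have g: "bounded_clinear g"
    unfolding g_def by (intro bounded_clinear_diff f bounded_clinear_cinner_left)
  have "g e = 0" if "e \<in> E" for e
    using cinner_has_sum[OF E that v] cinner_commute[of e v] by (simp add: g_def)
  then have "norm (g x) \<le> norm x * 0" for x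
    by (intro onb_norm_bound[OF basis g]) (auto intro!: eq_refl sum.neutral)
  then show ?thesis
    by (auto simp: g_def)
qed

definition cadjoint :: "('a::chilbert_space \<Rightarrow> 'b::chilbert_space) \<Rightarrow> 'b \<Rightarrow> 'a"
  where "cadjoint T = (SOME S. \<forall>x y. cinner (T x) y = cinner x (S y))"

lemma cinner_cadjoint:
  assumes "bounded_clinear T"
  shows "cinner (T x) y = cinner x (cadjoint T y)"
proof -
  have "\<exists>v. \<forall>x. cinner (T x) y = cinner x v" for y
    using riesz[OF bounded_clinear_compose[OF bounded_clinear_cinner_left assms]] .
  then have "\<exists>S. \<forall>x y. cinner (T x) y = cinner x (S y)"
    by metis
  from someI_ex[OF this] show ?thesis
    unfolding cadjoint_def by blast
qed

text \<open>The sum is independent of the basis for trace class operators.\<close>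
definition ctrace :: "('a::chilbert_space \<Rightarrow> 'a) \<Rightarrow> complex"
  where "ctrace T = (\<Sum>\<^sub>\<infinity>e\<in>some_onb. cinner (T e) e)"


section \<open>Hilbert--Schmidt operators\<close>

definition is_hilbert_schmidt :: "('a::chilbert_space \<Rightarrow> 'a) \<Rightarrow> bool"
  where "is_hilbert_schmidt T \<longleftrightarrow> bounded_clinear T \<and>
    (\<exists>E. orthonormal_basis E \<and> (\<lambda>e. (norm (T e))\<^sup>2) summable_on E)"

text \<open>By the next lemmas the choice of the basis is immaterial, here and in the norm; by
  polarization, it is also immaterial for the inner product \<open>Tr (B\<^sup>* A)\<close>.\<close>

lemma hs_sum_le:
  fixes T :: "'a::chilbert_space \<Rightarrow> 'b::chilbert_space"
  assumes T: "bounded_clinear T" and E: "orthonormal_basis E" and E': "orthonormal E'"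
    and s: "(\<lambda>e. (norm (T e))\<^sup>2) summable_on E" and F': "finite F'" "F' \<subseteq> E'"
  shows "(\<Sum>e\<in>F'. (norm (T e))\<^sup>2) \<le> (\<Sum>\<^sub>\<infinity>e\<in>E. (norm (T e))\<^sup>2)"
proof -
  define G :: "'b set" where "G = some_onb"
  have basis: "orthonormal_basis G" and G: "orthonormal G"
    using some_onb by (auto simp: G_def orthonormal_basis_def)
  have sym: "cmod (cinner (cadjoint T g) e) = cmod (cinner (T e) g)" for e g
    using cinner_cadjoint[OF T, of e g] cinner_commute[of e "cadjoint T g"] by simp
  have "((\<lambda>G0. \<Sum>f\<in>F'. \<Sum>g\<in>G0. (cmod (cinner (T f) g))\<^sup>2) \<longlongrightarrow> (\<Sum>f\<in>F'. (norm (T f))\<^sup>2))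
          (finite_subsets_at_top G)"
    by (intro tendsto_sum) (use parseval[OF basis] in \<open>simp add: has_sum_def\<close>)
  moreover have "(\<Sum>f\<in>F'. \<Sum>g\<in>G0. (cmod (cinner (T f) g))\<^sup>2) \<le> (\<Sum>\<^sub>\<infinity>e\<in>E. (norm (T e))\<^sup>2)"
    if G0: "finite G0" "G0 \<subseteq> G" for G0
  proof -
    have "(\<Sum>f\<in>F'. \<Sum>g\<in>G0. (cmod (cinner (T f) g))\<^sup>2)
        = (\<Sum>g\<in>G0. \<Sum>f\<in>F'. (cmod (cinner (cadjoint T g) f))\<^sup>2)"
      unfolding sym by (rule sum.swap)
    also have "\<dots> \<le> (\<Sum>g\<in>G0. (norm (cadjoint T g))\<^sup>2)"
      by (intro sum_mono bessel orthonormal_subset[OF E'] F')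
    also have "\<dots> \<le> (\<Sum>\<^sub>\<infinity>e\<in>E. (norm (T e))\<^sup>2)"
    proof (rule has_sum_le_finite_sums)
      show "((\<lambda>e. \<Sum>g\<in>G0. (cmod (cinner (cadjoint T g) e))\<^sup>2) has_sum
          (\<Sum>g\<in>G0. (norm (cadjoint T g))\<^sup>2)) E"
        using G0(1) parseval[OF E]
        by (induction G0 rule: finite_induct) (auto intro: has_sum_add)
      fix F assume F: "finite F" "F \<subseteq> E"
      have "(\<Sum>e\<in>F. \<Sum>g\<in>G0. (cmod (cinner (cadjoint T g) e))\<^sup>2) \<le> (\<Sum>e\<in>F. (norm (T e))\<^sup>2)"
        unfolding sym by (intro sum_mono bessel orthonormal_subset[OF G] G0)
      also have "\<dots> \<le> (\<Sum>\<^sub>\<infinity>e\<in>E. (norm (T e))\<^sup>2)"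
        by (rule finite_sum_le_infsum[OF s F]) simp
      finally show "(\<Sum>e\<in>F. \<Sum>g\<in>G0. (cmod (cinner (cadjoint T g) e))\<^sup>2)
          \<le> (\<Sum>\<^sub>\<infinity>e\<in>E. (norm (T e))\<^sup>2)" .
    qed
    finally show ?thesis .
  qed
  ultimately show ?thesis
    by (intro tendsto_upperbound[of _ _ "finite_subsets_at_top G"])
      (auto intro: eventually_finite_subsets_at_top_weakI)
qed

lemma hs_summable:
  assumes "is_hilbert_schmidt T" "orthonormal_basis E"
  shows "(\<lambda>e. (norm (T e))\<^sup>2) summable_on E"
proof -
  obtain E' where "bounded_clinear T" "orthonormal_basis E'" "(\<lambda>e. (norm (T e))\<^sup>2) summable_on E'"
    using assms by (auto simp: is_hilbert_schmidt_def)
  then have "(\<Sum>e\<in>F. (norm (T e))\<^sup>2) \<le> (\<Sum>\<^sub>\<infinity>e\<in>E'. (norm (T e))\<^sup>2)" if "finite F" "F \<subseteq> E" for F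
    using hs_sum_le that assms(2) by (auto simp: orthonormal_basis_def)
  then show ?thesis
    by (intro nonneg_bdd_above_summable_on) (auto simp: bdd_above_def)
qed

lemma hs_infsum_basis:
  assumes T: "is_hilbert_schmidt T" and E: "orthonormal_basis E" "orthonormal_basis E'"
  shows "(\<Sum>\<^sub>\<infinity>e\<in>E. (norm (T e))\<^sup>2) = (\<Sum>\<^sub>\<infinity>e\<in>E'. (norm (T e))\<^sup>2)"
proof (rule antisym)
  have "bounded_clinear T" "orthonormal E" "orthonormal E'"
    using assms by (auto simp: is_hilbert_schmidt_def orthonormal_basis_def)
  then show "(\<Sum>\<^sub>\<infinity>e\<in>E. (norm (T e))\<^sup>2) \<le> (\<Sum>\<^sub>\<infinity>e\<in>E'. (norm (T e))\<^sup>2)"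
      and "(\<Sum>\<^sub>\<infinity>e\<in>E'. (norm (T e))\<^sup>2) \<le> (\<Sum>\<^sub>\<infinity>e\<in>E. (norm (T e))\<^sup>2)"
    using hs_summable[OF T] E by (metis infsum_le_finite_sums hs_sum_le)+
qed

definition hs_norm :: "('a::chilbert_space \<Rightarrow> 'a) \<Rightarrow> real"
  where "hs_norm T = sqrt (\<Sum>\<^sub>\<infinity>e\<in>some_onb. (norm (T e))\<^sup>2)"

lemma hs_norm_nonneg: "hs_norm T \<ge> 0"
  by (simp add: hs_norm_def infsum_nonneg)

lemma hs_norm_sq: "(hs_norm T)\<^sup>2 = (\<Sum>\<^sub>\<infinity>e\<in>some_onb. (norm (T e))\<^sup>2)"
  by (simp add: hs_norm_def infsum_nonneg)

lemma hs_clinear: "is_hilbert_schmidt T \<Longrightarrow> bounded_clinear T"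
  by (simp add: is_hilbert_schmidt_def)

lemma hs_finite_sum_le:
  assumes "is_hilbert_schmidt T" "finite F" "F \<subseteq> some_onb"
  shows "(\<Sum>e\<in>F. (norm (T e))\<^sup>2) \<le> (hs_norm T)\<^sup>2"
  unfolding hs_norm_sq
  by (rule finite_sum_le_infsum[OF hs_summable[OF assms(1) some_onb] assms(2,3)]) simp

lemma hs_boundI:
  assumes "bounded_clinear T" "\<And>F. finite F \<Longrightarrow> F \<subseteq> some_onb \<Longrightarrow> (\<Sum>e\<in>F. (norm (T e))\<^sup>2) \<le> N\<^sup>2" "N \<ge> 0"
  shows "is_hilbert_schmidt T" and "hs_norm T \<le> N"
proof -
  have s: "(\<lambda>e. (norm (T e))\<^sup>2) summable_on some_onb"
    using assms(2) by (intro nonneg_bdd_above_summable_on) (auto simp: bdd_above_def)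
  then show "is_hilbert_schmidt T"
    using assms(1) some_onb unfolding is_hilbert_schmidt_def by blast
  have "(hs_norm T)\<^sup>2 \<le> N\<^sup>2"
    unfolding hs_norm_sq using s assms(2) by (rule infsum_le_finite_sums)
  then show "hs_norm T \<le> N"
    using assms(3) by (rule power2_le_imp_le)
qed

lemma hs_norm_bound: "is_hilbert_schmidt T \<Longrightarrow> norm (T x) \<le> norm x * hs_norm T"
  by (rule onb_norm_bound[OF some_onb]) (auto simp: hs_clinear hs_finite_sum_le hs_norm_nonneg)

lemma hs_L2_set_le:
  assumes "is_hilbert_schmidt T" "finite F" "F \<subseteq> some_onb"
  shows "L2_set (\<lambda>e. norm (T e)) F \<le> hs_norm T"
  unfolding L2_set_def
  by (rule real_le_lsqrt) (use hs_finite_sum_le[OF assms] in \<open>auto simp: sum_nonneg hs_norm_nonneg\<close>)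

lemma hs_zero: "is_hilbert_schmidt (\<lambda>x. 0)"
  by (rule hs_boundI[where N = 0]) (auto simp: bounded_clinear_const_zero)

lemma
  assumes A: "is_hilbert_schmidt A" and B: "is_hilbert_schmidt B"
  shows hs_add: "is_hilbert_schmidt (\<lambda>x. A x + B x)"
    and hs_norm_triangle: "hs_norm (\<lambda>x. A x + B x) \<le> hs_norm A + hs_norm B"
proof -
  have "(\<Sum>e\<in>F. (norm (A e + B e))\<^sup>2) \<le> (hs_norm A + hs_norm B)\<^sup>2" if F: "finite F" "F \<subseteq> some_onb" for F
  proof -
    have "L2_set (\<lambda>e. norm (A e + B e)) F \<le> L2_set (\<lambda>e. norm (A e) + norm (B e)) F"
      by (intro L2_set_mono norm_triangle_ineq) auto
    also have "\<dots> \<le> L2_set (\<lambda>e. norm (A e)) F + L2_set (\<lambda>e. norm (B e)) F"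
      by (rule L2_set_triangle_ineq)
    also have "\<dots> \<le> hs_norm A + hs_norm B"
      by (intro add_mono hs_L2_set_le A B F)
    finally show ?thesis
      unfolding L2_set_def by (rule sqrt_le_D)
  qed
  from hs_boundI[OF bounded_clinear_plus[OF A[THEN hs_clinear] B[THEN hs_clinear]] this]
  show "is_hilbert_schmidt (\<lambda>x. A x + B x)" "hs_norm (\<lambda>x. A x + B x) \<le> hs_norm A + hs_norm B"
    by (auto simp: hs_norm_nonneg)
qed

lemma
  assumes A: "is_hilbert_schmidt A" and B: "bounded_clinear B"
    and K: "\<And>x. norm (B x) \<le> norm x * K" "K \<ge> 0"
  shows hs_compose_left: "is_hilbert_schmidt (\<lambda>x. B (A x))"
    and hs_norm_compose_left: "hs_norm (\<lambda>x. B (A x)) \<le> K * hs_norm A"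
proof -
  have "(\<Sum>e\<in>F. (norm (B (A e)))\<^sup>2) \<le> (K * hs_norm A)\<^sup>2" if F: "finite F" "F \<subseteq> some_onb" for F
  proof -
    have "(\<Sum>e\<in>F. (norm (B (A e)))\<^sup>2) \<le> (\<Sum>e\<in>F. (norm (A e) * K)\<^sup>2)"
      by (intro sum_mono power_mono K) auto
    also have "\<dots> = K\<^sup>2 * (\<Sum>e\<in>F. (norm (A e))\<^sup>2)"
      by (simp add: power_mult_distrib mult.commute sum_distrib_left)
    also have "\<dots> \<le> K\<^sup>2 * (hs_norm A)\<^sup>2"
      by (intro mult_left_mono hs_finite_sum_le A F) auto
    finally show ?thesis
      by (simp add: power_mult_distrib)
  qed
  from hs_boundI[OF bounded_clinear_compose[OF B hs_clinear[OF A]] this]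
  show "is_hilbert_schmidt (\<lambda>x. B (A x))" "hs_norm (\<lambda>x. B (A x)) \<le> K * hs_norm A"
    using K by (auto simp: hs_norm_nonneg)
qed

lemma hs_scaleC: "is_hilbert_schmidt A \<Longrightarrow> is_hilbert_schmidt (\<lambda>x. c *\<^sub>C A x)"
  by (rule hs_compose_left[where K = "cmod c"])
    (auto simp: bounded_clinear_def bounded_linear_scaleC scaleC_scaleC norm_scaleC mult.commute)

lemma hs_uminus: "is_hilbert_schmidt A \<Longrightarrow> is_hilbert_schmidt (\<lambda>x. - A x)"
  using hs_scaleC[of A "-1"] by (simp add: scaleC_minus1)

lemma hs_diff: "is_hilbert_schmidt A \<Longrightarrow> is_hilbert_schmidt B \<Longrightarrow> is_hilbert_schmidt (\<lambda>x. A x - B x)"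
  using hs_add[OF _ hs_uminus] by simp

lemma hs_compose: "is_hilbert_schmidt A \<Longrightarrow> is_hilbert_schmidt B \<Longrightarrow> is_hilbert_schmidt (\<lambda>x. A (B x))"
  by (rule hs_compose_left[where K = "hs_norm A"])
    (auto simp: hs_clinear hs_norm_nonneg hs_norm_bound)

lemma hs_trace_adjoint:
  assumes "is_hilbert_schmidt B"
  shows "ctrace (\<lambda>x. cadjoint B (A x)) = (\<Sum>\<^sub>\<infinity>e\<in>some_onb. cinner (A e) (B e))"
  unfolding ctrace_def
proof (rule infsum_cong)
  fix e
  show "cinner (cadjoint B (A e)) e = cinner (A e) (B e)"
    using cinner_cadjoint[OF hs_clinear[OF assms], of e "A e"] cinner_commute by metis
qed

lemma hs_inner_summable:
  assumes A: "is_hilbert_schmidt A" and B: "is_hilbert_schmidt B"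
  shows "(\<lambda>e. cinner (A e) (B e)) summable_on some_onb"
proof (rule abs_summable_summable, rule Infinite_Sum.abs_summable_on_comparison_test')
  show "(\<lambda>e. (norm (A e))\<^sup>2 + (norm (B e))\<^sup>2) summable_on some_onb"
    by (intro summable_on_add hs_summable A B some_onb)
  show "cmod (cinner (A e) (B e)) \<le> (norm (A e))\<^sup>2 + (norm (B e))\<^sup>2" for e
  proof -
    have "2 * (norm (A e) * norm (B e)) \<le> (norm (A e))\<^sup>2 + (norm (B e))\<^sup>2"
      using sum_squares_bound[of "norm (A e)" "norm (B e)"] by simp
    moreover have "0 \<le> norm (A e) * norm (B e)"
      by simp
    ultimately show ?thesis
      using cinner_Cauchy_Schwarz[of "A e" "B e"] by linarith
  qed
qed

lemma hs_trace_norm: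
  assumes "is_hilbert_schmidt A"
  shows "ctrace (\<lambda>x. cadjoint A (A x)) = complex_of_real ((hs_norm A)\<^sup>2)"
  unfolding hs_trace_adjoint[OF assms] hs_norm_sq cinner_norm
  by (rule infsumI, rule has_sum_bounded_linear[OF bounded_linear_of_real])
    (rule has_sum_infsum[OF hs_summable[OF assms some_onb]])

typedef (overloaded) 'a hilbert_schmidt = "{T :: 'a::chilbert_space \<Rightarrow> 'a. is_hilbert_schmidt T}"
  morphisms hs_apply Abs_hilbert_schmidt
  using hs_zero by blast

setup_lifting type_definition_hilbert_schmidt

lemma hs_apply: "is_hilbert_schmidt (hs_apply A)"
  using hs_apply by simp

lemma hs_eqI: "(\<And>x. hs_apply A x = hs_apply B x) \<Longrightarrow> A = B"
  by (simp add: hs_apply_inject[symmetric] ext)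

instantiation hilbert_schmidt :: (chilbert_space) complex_inner
begin

lift_definition zero_hilbert_schmidt :: "'a hilbert_schmidt" is "\<lambda>x. 0"
  by (rule hs_zero)
lift_definition plus_hilbert_schmidt :: "'a hilbert_schmidt \<Rightarrow> 'a hilbert_schmidt \<Rightarrow> 'a hilbert_schmidt"
  is "\<lambda>A B x. A x + B x" by (rule hs_add)
lift_definition minus_hilbert_schmidt :: "'a hilbert_schmidt \<Rightarrow> 'a hilbert_schmidt \<Rightarrow> 'a hilbert_schmidt"
  is "\<lambda>A B x. A x - B x" by (rule hs_diff)
lift_definition uminus_hilbert_schmidt :: "'a hilbert_schmidt \<Rightarrow> 'a hilbert_schmidt"
  is "\<lambda>A x. - A x" by (rule hs_uminus)
lift_definition scaleC_hilbert_schmidt :: "complex \<Rightarrow> 'a hilbert_schmidt \<Rightarrow> 'a hilbert_schmidt"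
  is "\<lambda>c A x. c *\<^sub>C A x" by (rule hs_scaleC)
lift_definition cinner_hilbert_schmidt :: "'a hilbert_schmidt \<Rightarrow> 'a hilbert_schmidt \<Rightarrow> complex"
  is "\<lambda>A B. ctrace (\<lambda>x. cadjoint B (A x))" .

definition scaleR_hilbert_schmidt :: "real \<Rightarrow> 'a hilbert_schmidt \<Rightarrow> 'a hilbert_schmidt"
  where "scaleR_hilbert_schmidt r A = complex_of_real r *\<^sub>C A"
definition norm_hilbert_schmidt :: "'a hilbert_schmidt \<Rightarrow> real"
  where "norm_hilbert_schmidt A = sqrt (cmod (cinner A A))"
definition dist_hilbert_schmidt :: "'a hilbert_schmidt \<Rightarrow> 'a hilbert_schmidt \<Rightarrow> real"
  where "dist_hilbert_schmidt A B = norm (A - B)"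
definition sgn_hilbert_schmidt :: "'a hilbert_schmidt \<Rightarrow> 'a hilbert_schmidt"
  where "sgn_hilbert_schmidt A = inverse (norm A) *\<^sub>R A"
definition uniformity_hilbert_schmidt :: "('a hilbert_schmidt \<times> 'a hilbert_schmidt) filter"
  where "uniformity_hilbert_schmidt = (INF e\<in>{0 <..}. principal {(x, y). dist x y < e})"
definition open_hilbert_schmidt :: "'a hilbert_schmidt set \<Rightarrow> bool"
  where "open_hilbert_schmidt U \<longleftrightarrow> (\<forall>x\<in>U. eventually (\<lambda>(x', y). x' = x \<longrightarrow> y \<in> U) uniformity)"

lemma norm_hs_eq: "norm A = hs_norm (hs_apply A)"
  by (simp add: norm_hilbert_schmidt_def cinner_hilbert_schmidt.rep_eq hs_trace_norm hs_apply
      hs_norm_nonneg del: of_real_power)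

lemma cinner_hs_eq: "cinner A B = (\<Sum>\<^sub>\<infinity>e\<in>some_onb. cinner (hs_apply A e) (hs_apply B e))"
  by (simp add: cinner_hilbert_schmidt.rep_eq hs_trace_adjoint hs_apply)

instance
proof
  fix A B C :: "'a hilbert_schmidt" and a b :: complex and r s :: real
  show "A + B + C = A + (B + C)" "A + B = B + A" "0 + A = A" "- A + A = 0" "A - B = A + - B"
    by (transfer, simp add: algebra_simps)+
  show "a *\<^sub>C (A + B) = a *\<^sub>C A + a *\<^sub>C B" "(a + b) *\<^sub>C A = a *\<^sub>C A + b *\<^sub>C A"
      "a *\<^sub>C b *\<^sub>C A = (a * b) *\<^sub>C A"
    by (transfer, simp add: scaleC_add_right scaleC_add_left scaleC_scaleC)+
  note C = this
  show "complex_of_real r *\<^sub>C A = r *\<^sub>R A"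
    by (simp add: scaleR_hilbert_schmidt_def)
  show "r *\<^sub>R (A + B) = r *\<^sub>R A + r *\<^sub>R B" "(r + s) *\<^sub>R A = r *\<^sub>R A + s *\<^sub>R A"
    "r *\<^sub>R s *\<^sub>R A = (r * s) *\<^sub>R A" "1 *\<^sub>R A = A"
    unfolding scaleR_hilbert_schmidt_def
    by (transfer, simp add: scaleC_add_right scaleC_add_left scaleC_scaleC)+
  show "dist A B = norm (A - B)" "sgn A = inverse (norm A) *\<^sub>R A"
    by (simp_all add: dist_hilbert_schmidt_def sgn_hilbert_schmidt_def)
  show "uniformity = (INF e\<in>{0 <..}. principal {(x :: 'a hilbert_schmidt, y). dist x y < e})"
    by (simp add: uniformity_hilbert_schmidt_def)
  show "open U \<longleftrightarrow> (\<forall>x\<in>U. eventually (\<lambda>(x', y). x' = x \<longrightarrow> y \<in> U) uniformity)"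
    for U :: "'a hilbert_schmidt set"
    by (simp add: open_hilbert_schmidt_def)
  show triangle: "norm (A + B) \<le> norm A + norm B"
    by (simp add: norm_hs_eq plus_hilbert_schmidt.rep_eq hs_norm_triangle hs_apply)
  show "cinner (A + B) C = cinner A C + cinner B C"
    by (simp add: cinner_hs_eq plus_hilbert_schmidt.rep_eq cinner_add_left infsum_add
        hs_inner_summable hs_apply)
  show left: "cinner (a *\<^sub>C A) B = a * cinner A B" for A B :: "'a hilbert_schmidt" and a
    by (simp add: cinner_hs_eq scaleC_hilbert_schmidt.rep_eq cinner_scaleC_left infsum_cmult_right')
  show comm: "cinner A B = cnj (cinner B A)" for A B :: "'a hilbert_schmidt"
    unfolding cinner_hs_eq infsum_cnj[symmetric] by (rule infsum_cong) (rule cinner_commute)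
  show "cinner A A = complex_of_real ((norm A)\<^sup>2)"
    by (simp add: cinner_hilbert_schmidt.rep_eq hs_trace_norm hs_apply norm_hs_eq)
  show scale: "norm (a *\<^sub>C A) = cmod a * norm A" for a and A :: "'a hilbert_schmidt"
  proof -
    have "cinner (a *\<^sub>C A) (a *\<^sub>C A) = a * cnj a * cinner A A"
      using left[of a A "a *\<^sub>C A"] comm[of A "a *\<^sub>C A"] left[of a A A] comm[of A A] by simp
    then show ?thesis
      by (simp add: norm_hilbert_schmidt_def norm_mult real_sqrt_mult)
  qed
  show "norm (r *\<^sub>R A) = \<bar>r\<bar> * norm A"
    by (simp add: scaleR_hilbert_schmidt_def scale)
  show "(norm A = 0) = (A = 0)"
  proof
    assume "norm A = 0"
    then have "hs_apply A x = 0" for x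
      using hs_norm_bound[OF hs_apply, of A x] by (simp add: norm_hs_eq)
    then show "A = 0"
      by (intro hs_eqI) (simp add: zero_hilbert_schmidt.rep_eq)
  next
    assume "A = 0"
    then show "norm A = 0"
      by (simp add: norm_hs_eq hs_norm_def zero_hilbert_schmidt.rep_eq)
  qed
qed

end

lemma hs_apply_norm: "norm (hs_apply A x) \<le> norm x * norm A"
  using hs_norm_bound[OF hs_apply] by (simp add: norm_hs_eq)

lemma hs_complete:
  fixes X :: "nat \<Rightarrow> 'a::chilbert_space hilbert_schmidt"
  assumes X: "Cauchy X"
  shows "convergent X"
proof -
  have "Cauchy (\<lambda>n. hs_apply (X n) x)" for x
  proof (rule metric_CauchyI)
    fix e :: real assume "e > 0"
    then have "e / (norm x + 1) > 0"
      by (simp add: add_nonneg_pos)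
    then obtain M where M: "\<And>m n. m \<ge> M \<Longrightarrow> n \<ge> M \<Longrightarrow> dist (X m) (X n) < e / (norm x + 1)"
      using metric_CauchyD[OF X] by blast
    have "dist (hs_apply (X m) x) (hs_apply (X n) x) < e" if "m \<ge> M" "n \<ge> M" for m n
    proof -
      have "dist (hs_apply (X m) x) (hs_apply (X n) x) \<le> norm x * dist (X m) (X n)"
        using hs_apply_norm[of "X m - X n" x] by (simp add: dist_norm minus_hilbert_schmidt.rep_eq)
      also have "\<dots> \<le> (norm x + 1) * dist (X m) (X n)"
        by (intro mult_right_mono) auto
      also have "\<dots> < e"
        using mult_strict_left_mono[OF M[OF that], of "norm x + 1"]
        by (simp add: add_nonneg_pos add_pos_nonneg less_imp_neq[THEN not_sym])
      finally show ?thesis .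
    qed
    then show "\<exists>M. \<forall>m\<ge>M. \<forall>n\<ge>M. dist (hs_apply (X m) x) (hs_apply (X n) x) < e"
      by blast
  qed
  then have "\<exists>y. (\<lambda>n. hs_apply (X n) x) \<longlonglongrightarrow> y" for x
    by (simp add: Cauchy_convergent_iff convergent_def)
  then obtain T where T: "\<And>x. (\<lambda>n. hs_apply (X n) x) \<longlonglongrightarrow> T x"
    by metis
  have "bounded (range X)"
    using X by (rule cauchy_imp_bounded)
  then obtain K where K: "\<And>n. norm (X n) \<le> K"
    by (auto simp: bounded_iff)
  have Tlin: "bounded_clinear T"
  proof (rule bounded_clinear_lim[OF hs_clinear[OF hs_apply] T])
    show "norm (hs_apply (X n) x) \<le> norm x * K" for n x
      using hs_apply_norm[of "X n" x] mult_left_mono[OF K[of n] norm_ge_zero[of x]] by linarith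
  qed
  have close: "\<exists>M. \<forall>n\<ge>M. is_hilbert_schmidt (\<lambda>x. T x - hs_apply (X n) x) \<and>
      hs_norm (\<lambda>x. T x - hs_apply (X n) x) \<le> e" if e: "e > 0" for e
  proof -
    obtain M where M: "\<And>m n. m \<ge> M \<Longrightarrow> n \<ge> M \<Longrightarrow> dist (X m) (X n) < e"
      using metric_CauchyD[OF X e] by blast
    have "(\<Sum>b\<in>F. (norm (T b - hs_apply (X n) b))\<^sup>2) \<le> e\<^sup>2"
      if n: "n \<ge> M" and F: "finite F" "F \<subseteq> some_onb" for n F
    proof (rule tendsto_upperbound)
      show "(\<lambda>m. \<Sum>b\<in>F. (norm (hs_apply (X m) b - hs_apply (X n) b))\<^sup>2)
          \<longlonglongrightarrow> (\<Sum>b\<in>F. (norm (T b - hs_apply (X n) b))\<^sup>2)"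
        by (intro tendsto_intros T)
      show "\<forall>\<^sub>F m in sequentially. (\<Sum>b\<in>F. (norm (hs_apply (X m) b - hs_apply (X n) b))\<^sup>2) \<le> e\<^sup>2"
        using eventually_ge_at_top[of M]
      proof eventually_elim
        case (elim m)
        have "(\<Sum>b\<in>F. (norm (hs_apply (X m) b - hs_apply (X n) b))\<^sup>2) \<le> (norm (X m - X n))\<^sup>2"
          using hs_finite_sum_le[OF hs_apply F, of "X m - X n"]
          by (simp add: norm_hs_eq minus_hilbert_schmidt.rep_eq)
        also have "\<dots> \<le> e\<^sup>2"
          using M[OF elim n] by (intro power_mono) (auto simp: dist_norm)
        finally show ?case .
      qed
    qed simp
    then have "is_hilbert_schmidt (\<lambda>x. T x - hs_apply (X n) x) \<and>
      hs_norm (\<lambda>x. T x - hs_apply (X n) x) \<le> e" if "n \<ge> M" for n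
      using hs_boundI[OF bounded_clinear_diff[OF Tlin hs_clinear[OF hs_apply]], where N = e] that e
      by (metis less_imp_le)
    then show ?thesis
      by blast
  qed
  obtain n where "is_hilbert_schmidt (\<lambda>x. T x - hs_apply (X n) x)"
    using close[of 1] by auto
  from hs_add[OF this hs_apply[of "X n"]] have "is_hilbert_schmidt T"
    by simp
  then obtain L where L: "hs_apply L = T"
    using Abs_hilbert_schmidt_inverse by blast
  have "X \<longlonglongrightarrow> L"
  proof (rule LIMSEQ_I)
    fix e :: real assume "e > 0"
    then obtain M where M: "\<And>n. n \<ge> M \<Longrightarrow> norm (L - X n) \<le> e/2"
      using close[of "e/2"] by (auto simp: norm_hs_eq minus_hilbert_schmidt.rep_eq L)
    then have "norm (X n - L) < e" if "n \<ge> M" for n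
      using M[OF that] \<open>e > 0\<close> by (simp add: norm_minus_commute)
    then show "\<exists>no. \<forall>n\<ge>no. norm (X n - L) < e"
      by blast
  qed
  then show ?thesis
    by (auto simp: convergent_def)
qed

instance hilbert_schmidt :: (chilbert_space) chilbert_space
  by standard (rule hs_complete)

instantiation hilbert_schmidt :: (chilbert_space) complex_banach_algebra
begin

lift_definition times_hilbert_schmidt :: "'a hilbert_schmidt \<Rightarrow> 'a hilbert_schmidt \<Rightarrow> 'a hilbert_schmidt"
  is "\<lambda>A B x. A (B x)" by (rule hs_compose)

instance
proof
  fix A B C :: "'a hilbert_schmidt" and a :: complex and r :: real
  show "A * B * C = A * (B * C)" "(A + B) * C = A * C + B * C"
    by (transfer, simp)+
  show "A * (B + C) = A * B + A * C"
    by (transfer, simp add: bounded_clinear_add hs_clinear)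
  show left: "(a *\<^sub>C A) * B = a *\<^sub>C (A * B)" for a
    by (transfer, simp)
  show right: "A * (a *\<^sub>C B) = a *\<^sub>C (A * B)" for a
    by (transfer, simp add: bounded_clinear_scaleC hs_clinear)
  show "(r *\<^sub>R A) * B = r *\<^sub>R (A * B)" "A * (r *\<^sub>R B) = r *\<^sub>R (A * B)"
    by (simp_all add: left right flip: scaleC_of_real)
  show "norm (A * B) \<le> norm A * norm B"
    using hs_norm_compose_left[OF hs_apply hs_clinear[OF hs_apply] hs_norm_bound[OF hs_apply] hs_norm_nonneg, of A B]
    by (simp add: norm_hs_eq times_hilbert_schmidt.rep_eq)
qed

end


section \<open>Compact operators\<close>

definition is_compact_op :: "('a::complex_normed_vector \<Rightarrow> 'a) \<Rightarrow> bool"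
  where "is_compact_op T \<longleftrightarrow> bounded_clinear T \<and> compact (closure (T ` cball 0 1))"

lemma compact_op_clinear: "is_compact_op T \<Longrightarrow> bounded_clinear T"
  by (simp add: is_compact_op_def)

lemma compact_op_linear: "is_compact_op T \<Longrightarrow> bounded_linear T"
  by (simp add: is_compact_op_def bounded_clinear_def)

lemma compact_opI:
  assumes "bounded_clinear T" "compact K" "T ` cball 0 1 \<subseteq> K"
  shows "is_compact_op T"
proof -
  have "closure (T ` cball 0 1) \<subseteq> K"
    using assms compact_imp_closed closure_minimal by blast
  then have "compact (closure (T ` cball 0 1))"
    using assms(2) closed_closure compact_Int_closed Int_absorb1 by metis
  then show ?thesis
    using assms(1) by (simp add: is_compact_op_def)
qed

lemma compact_op_zero: "is_compact_op (\<lambda>x. 0)"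
  by (rule compact_opI[where K = "{0}"]) (auto simp: bounded_clinear_const_zero)

lemma compact_op_add:
  assumes A: "is_compact_op A" and B: "is_compact_op B"
  shows "is_compact_op (\<lambda>x. A x + B x)"
proof (rule compact_opI)
  show "bounded_clinear (\<lambda>x. A x + B x)"
    using A B by (simp add: is_compact_op_def bounded_clinear_plus)
  show "compact {x + y |x y. x \<in> closure (A ` cball 0 1) \<and> y \<in> closure (B ` cball 0 1)}"
    using A B by (intro compact_sums) (auto simp: is_compact_op_def)
  show "(\<lambda>x. A x + B x) ` cball 0 1 \<subseteq>
      {x + y |x y. x \<in> closure (A ` cball 0 1) \<and> y \<in> closure (B ` cball 0 1)}"
    using closure_subset by blast
qed

lemma compact_op_compose_left:
  assumes A: "is_compact_op A" and B: "bounded_clinear B"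
  shows "is_compact_op (\<lambda>x. B (A x))"
proof (rule compact_opI)
  show "bounded_clinear (\<lambda>x. B (A x))"
    using A B by (simp add: is_compact_op_def bounded_clinear_compose)
  show "compact (B ` closure (A ` cball 0 1))"
    using A B by (intro compact_continuous_image)
      (auto simp: is_compact_op_def bounded_clinear_def linear_continuous_on)
  show "(\<lambda>x. B (A x)) ` cball 0 1 \<subseteq> B ` closure (A ` cball 0 1)"
    using closure_subset by blast
qed

lemma bounded_clinear_scaleC_self: "bounded_clinear (\<lambda>x. c *\<^sub>C x)"
  by (auto simp: bounded_clinear_def bounded_linear_scaleC scaleC_scaleC mult.commute)

lemma compact_op_scaleC: "is_compact_op A \<Longrightarrow> is_compact_op (\<lambda>x. c *\<^sub>C A x)"
  by (rule compact_op_compose_left[OF _ bounded_clinear_scaleC_self])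

lemma compact_op_uminus: "is_compact_op A \<Longrightarrow> is_compact_op (\<lambda>x. - A x)"
  using compact_op_scaleC[of A "-1"] by (simp add: scaleC_minus1)

lemma compact_op_diff: "is_compact_op A \<Longrightarrow> is_compact_op B \<Longrightarrow> is_compact_op (\<lambda>x. A x - B x)"
  using compact_op_add[OF _ compact_op_uminus] by simp

lemma compact_op_compose: "is_compact_op A \<Longrightarrow> is_compact_op B \<Longrightarrow> is_compact_op (\<lambda>x. A (B x))"
  by (simp add: compact_op_compose_left compact_op_clinear)

typedef (overloaded) 'a compact_op = "{T :: 'a::complex_normed_vector \<Rightarrow> 'a. is_compact_op T}"
  morphisms op_apply Abs_compact_op
  using compact_op_zero by blast

setup_lifting type_definition_compact_op

lemma op_apply: "is_compact_op (op_apply A)"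
  using op_apply by simp

lemma op_apply_linear: "bounded_linear (op_apply A)"
  by (simp add: op_apply compact_op_linear)

lemma op_eqI: "(\<And>x. op_apply A x = op_apply B x) \<Longrightarrow> A = B"
  by (simp add: op_apply_inject[symmetric] ext)

instantiation compact_op :: (complex_normed_vector) complex_normed_algebra
begin

lift_definition zero_compact_op :: "'a compact_op" is "\<lambda>x. 0"
  by (rule compact_op_zero)
lift_definition plus_compact_op :: "'a compact_op \<Rightarrow> 'a compact_op \<Rightarrow> 'a compact_op"
  is "\<lambda>A B x. A x + B x" by (rule compact_op_add)
lift_definition minus_compact_op :: "'a compact_op \<Rightarrow> 'a compact_op \<Rightarrow> 'a compact_op"
  is "\<lambda>A B x. A x - B x" by (rule compact_op_diff)
lift_definition uminus_compact_op :: "'a compact_op \<Rightarrow> 'a compact_op"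
  is "\<lambda>A x. - A x" by (rule compact_op_uminus)
lift_definition times_compact_op :: "'a compact_op \<Rightarrow> 'a compact_op \<Rightarrow> 'a compact_op"
  is "\<lambda>A B x. A (B x)" by (rule compact_op_compose)
lift_definition scaleC_compact_op :: "complex \<Rightarrow> 'a compact_op \<Rightarrow> 'a compact_op"
  is "\<lambda>c A x. c *\<^sub>C A x" by (rule compact_op_scaleC)
lift_definition norm_compact_op :: "'a compact_op \<Rightarrow> real" is onorm .

definition scaleR_compact_op :: "real \<Rightarrow> 'a compact_op \<Rightarrow> 'a compact_op"
  where "scaleR_compact_op r A = complex_of_real r *\<^sub>C A"
definition dist_compact_op :: "'a compact_op \<Rightarrow> 'a compact_op \<Rightarrow> real"
  where "dist_compact_op A B = norm (A - B)"
definition sgn_compact_op :: "'a compact_op \<Rightarrow> 'a compact_op"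
  where "sgn_compact_op A = inverse (norm A) *\<^sub>R A"
definition uniformity_compact_op :: "('a compact_op \<times> 'a compact_op) filter"
  where "uniformity_compact_op = (INF e\<in>{0 <..}. principal {(x, y). dist x y < e})"
definition open_compact_op :: "'a compact_op set \<Rightarrow> bool"
  where "open_compact_op U \<longleftrightarrow> (\<forall>x\<in>U. eventually (\<lambda>(x', y). x' = x \<longrightarrow> y \<in> U) uniformity)"

instance
proof
  fix A B C :: "'a compact_op" and a b :: complex and r s :: real
  show "A + B + C = A + (B + C)" "A + B = B + A" "0 + A = A" "- A + A = 0" "A - B = A + - B"
    by (transfer, simp add: algebra_simps)+
  show "a *\<^sub>C (A + B) = a *\<^sub>C A + a *\<^sub>C B" "(a + b) *\<^sub>C A = a *\<^sub>C A + b *\<^sub>C A"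
      "a *\<^sub>C b *\<^sub>C A = (a * b) *\<^sub>C A"
    by (transfer, simp add: scaleC_add_right scaleC_add_left scaleC_scaleC)+
  show real: "complex_of_real r *\<^sub>C A = r *\<^sub>R A" for r and A :: "'a compact_op"
    by (simp add: scaleR_compact_op_def)
  show "r *\<^sub>R (A + B) = r *\<^sub>R A + r *\<^sub>R B" "(r + s) *\<^sub>R A = r *\<^sub>R A + s *\<^sub>R A"
    "r *\<^sub>R s *\<^sub>R A = (r * s) *\<^sub>R A" "1 *\<^sub>R A = A"
    unfolding scaleR_compact_op_def
    by (transfer, simp add: scaleC_add_right scaleC_add_left scaleC_scaleC)+
  show "dist A B = norm (A - B)" "sgn A = inverse (norm A) *\<^sub>R A"
    by (simp_all add: dist_compact_op_def sgn_compact_op_def)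
  show "uniformity = (INF e\<in>{0 <..}. principal {(x :: 'a compact_op, y). dist x y < e})"
    by (simp add: uniformity_compact_op_def)
  show "open U \<longleftrightarrow> (\<forall>x\<in>U. eventually (\<lambda>(x', y). x' = x \<longrightarrow> y \<in> U) uniformity)"
    for U :: "'a compact_op set"
    by (simp add: open_compact_op_def)
  show "norm (A + B) \<le> norm A + norm B"
    by (simp add: norm_compact_op.rep_eq plus_compact_op.rep_eq onorm_triangle op_apply_linear)
  show scale: "norm (a *\<^sub>C A) = cmod a * norm A" for a and A :: "'a compact_op"
  proof -
    have le: "norm (a *\<^sub>C A) \<le> cmod a * norm A" for a and A :: "'a compact_op"
      unfolding norm_compact_op.rep_eq scaleC_compact_op.rep_eq
    proof (rule onorm_bound)
      show "norm (a *\<^sub>C op_apply A x) \<le> cmod a * onorm (op_apply A) * norm x" for x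
        using onorm[OF op_apply_linear, of A x] by (simp add: norm_scaleC mult.assoc mult_left_mono)
    qed (simp add: onorm_pos_le op_apply_linear)
    show ?thesis
    proof (cases "a = 0")
      case True
      moreover have "0 \<le> norm (a *\<^sub>C A)"
        unfolding norm_compact_op.rep_eq by (rule onorm_pos_le[OF op_apply_linear])
      ultimately show ?thesis
        using le[of a A] by simp
    next
      case False
      have "inverse a *\<^sub>C a *\<^sub>C A = A"
        using False by (transfer, simp add: scaleC_scaleC)
      then have "norm A \<le> cmod (inverse a) * norm (a *\<^sub>C A)"
        using le[of "inverse a" "a *\<^sub>C A"] by simp
      then have "cmod a * norm A \<le> norm (a *\<^sub>C A)"
        using False by (simp add: norm_divide field_simps)
      then show ?thesis
        using le[of a A] by simp
    qed
  qed
  show "norm (r *\<^sub>R A) = \<bar>r\<bar> * norm A"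
    by (simp add: scaleR_compact_op_def scale)
  show "(norm A = 0) = (A = 0)"
    unfolding norm_compact_op.rep_eq onorm_eq_0[OF op_apply_linear]
    by (auto simp: zero_compact_op.rep_eq intro!: op_eqI)
  show "A * B * C = A * (B * C)" "(A + B) * C = A * C + B * C"
    by (transfer, simp)+
  show "A * (B + C) = A * B + A * C"
    by (transfer, simp add: bounded_clinear_add compact_op_clinear)
  show left: "(a *\<^sub>C A) * B = a *\<^sub>C (A * B)" for a
    by (transfer, simp)
  show right: "A * (a *\<^sub>C B) = a *\<^sub>C (A * B)" for a
    by (transfer, simp add: bounded_clinear_scaleC compact_op_clinear)
  show "(r *\<^sub>R A) * B = r *\<^sub>R (A * B)" "A * (r *\<^sub>R B) = r *\<^sub>R (A * B)"
    by (simp_all add: left right flip: real)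
  show "norm (A * B) \<le> norm A * norm B"
    unfolding norm_compact_op.rep_eq times_compact_op.rep_eq
    using onorm_compose[OF op_apply_linear op_apply_linear, of A B] by (simp add: o_def)
qed

end

lemma op_apply_norm: "norm (op_apply A x) \<le> norm x * norm A"
  using onorm[OF op_apply_linear, of A x] by (simp add: norm_compact_op.rep_eq mult.commute)

lemma compact_op_limit:
  fixes T :: "'a::complex_banach \<Rightarrow> 'a"
  assumes T: "bounded_clinear T"
    and approx: "\<And>e. e > 0 \<Longrightarrow> \<exists>A. is_compact_op A \<and> (\<forall>x\<in>cball 0 1. norm (T x - A x) \<le> e)"
  shows "is_compact_op T"
proof -
  have "\<exists>k. finite k \<and> closure (T ` cball 0 1) \<subseteq> (\<Union>x\<in>k. ball x e)" if "e > 0" for e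
  proof -
    have e4: "e/4 > 0" using that by simp
    obtain A where A: "is_compact_op A" and close: "\<And>x. x \<in> cball 0 1 \<Longrightarrow> norm (T x - A x) \<le> e/4"
      using approx[OF e4] by blast
    have "compact (closure (A ` cball 0 1))"
      using A by (simp add: is_compact_op_def)
    then obtain k where k: "finite k" "closure (A ` cball 0 1) \<subseteq> (\<Union>x\<in>k. ball x (e/4))"
      using e4 unfolding compact_eq_totally_bounded by blast
    have "T ` cball 0 1 \<subseteq> (\<Union>x\<in>k. cball x (e/2))"
    proof
      fix y assume "y \<in> T ` cball 0 1"
      then obtain x where x: "x \<in> cball 0 1" "y = T x"
        by blast
      then have "A x \<in> closure (A ` cball 0 1)"
        by (meson closure_subset imageI subsetD)
      then obtain z where z: "z \<in> k" "dist z (A x) < e/4"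
        using k(2) by auto
      have "dist (A x) (T x) \<le> e/4"
        using close[OF x(1)] by (simp add: dist_norm norm_minus_commute)
      then have "dist z y \<le> e/2"
        using z(2) x(2) dist_triangle[of z "T x" "A x"] by simp
      then show "y \<in> (\<Union>x\<in>k. cball x (e/2))"
        using z(1) by auto
    qed
    then have "closure (T ` cball 0 1) \<subseteq> (\<Union>x\<in>k. cball x (e/2))"
      using k(1) by (intro closure_minimal closed_UN) auto
    moreover have "cball x (e/2) \<subseteq> ball x e" for x :: 'a
      using that by auto
    ultimately show ?thesis
      using k(1) by (intro exI[of _ k]) blast
  qed
  moreover have "complete (closure (T ` cball 0 1))"
    by (simp add: complete_eq_closed)
  ultimately show ?thesis
    using T by (simp add: is_compact_op_def compact_eq_totally_bounded)
qed

lemma compact_op_complete: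
  fixes X :: "nat \<Rightarrow> 'a::complex_banach compact_op"
  assumes X: "Cauchy X"
  shows "convergent X"
proof -
  have CX: "\<exists>M. \<forall>m\<ge>M. \<forall>n\<ge>M. norm (X m - X n) < e" if "e > 0" for e
    using metric_CauchyD[OF X that] by (simp add: dist_norm)
  have "Cauchy (\<lambda>n. op_apply (X n) x)" for x
  proof (rule CauchyI)
    fix e :: real assume "e > 0"
    then have "e / (norm x + 1) > 0"
      by (simp add: add_nonneg_pos)
    then obtain M where M: "\<And>m n. m \<ge> M \<Longrightarrow> n \<ge> M \<Longrightarrow> norm (X m - X n) < e / (norm x + 1)"
      using CX by blast
    have "norm (op_apply (X m) x - op_apply (X n) x) < e" if "m \<ge> M" "n \<ge> M" for m n
    proof -
      have "norm (op_apply (X m) x - op_apply (X n) x) \<le> norm x * norm (X m - X n)"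
        using op_apply_norm[of "X m - X n" x] by (simp add: minus_compact_op.rep_eq)
      also have "\<dots> \<le> (norm x + 1) * norm (X m - X n)"
        by (intro mult_right_mono) auto
      also have "\<dots> < e"
        using mult_strict_left_mono[OF M[OF that], of "norm x + 1"]
        by (simp add: add_nonneg_pos add_pos_nonneg less_imp_neq[THEN not_sym])
      finally show ?thesis .
    qed
    then show "\<exists>M. \<forall>m\<ge>M. \<forall>n\<ge>M. norm (op_apply (X m) x - op_apply (X n) x) < e"
      by blast
  qed
  then have "\<exists>y. (\<lambda>n. op_apply (X n) x) \<longlonglongrightarrow> y" for x
    by (simp add: Cauchy_convergent_iff convergent_def)
  then obtain T where T: "\<And>x. (\<lambda>n. op_apply (X n) x) \<longlonglongrightarrow> T x"
    by metis
  have "bounded (range X)"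
    using X by (rule cauchy_imp_bounded)
  then obtain K where K: "\<And>n. norm (X n) \<le> K"
    by (auto simp: bounded_iff)
  have Tlin: "bounded_clinear T"
  proof (rule bounded_clinear_lim[OF compact_op_clinear[OF op_apply] T])
    show "norm (op_apply (X n) x) \<le> norm x * K" for n x
      using op_apply_norm[of "X n" x] mult_left_mono[OF K[of n] norm_ge_zero[of x]] by linarith
  qed
  have close: "\<exists>M. \<forall>n\<ge>M. \<forall>x. norm (T x - op_apply (X n) x) \<le> e * norm x" if e: "e > 0" for e
  proof -
    obtain M where M: "\<And>m n. m \<ge> M \<Longrightarrow> n \<ge> M \<Longrightarrow> norm (X m - X n) < e"
      using CX[OF e] by blast
    have "norm (T x - op_apply (X n) x) \<le> e * norm x" if n: "n \<ge> M" for n x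
    proof (rule tendsto_upperbound)
      show "(\<lambda>m. norm (op_apply (X m) x - op_apply (X n) x)) \<longlonglongrightarrow> norm (T x - op_apply (X n) x)"
        by (intro tendsto_intros T)
      show "\<forall>\<^sub>F m in sequentially. norm (op_apply (X m) x - op_apply (X n) x) \<le> e * norm x"
        using eventually_ge_at_top[of M]
      proof eventually_elim
        case (elim m)
        have "norm (op_apply (X m) x - op_apply (X n) x) \<le> norm x * norm (X m - X n)"
          using op_apply_norm[of "X m - X n" x] by (simp add: minus_compact_op.rep_eq)
        also have "\<dots> \<le> norm x * e"
          using M[OF elim n] by (intro mult_left_mono) auto
        finally show ?case
          by (simp add: mult.commute)
      qed
    qed simp
    then show ?thesis
      by blast
  qed
  have "is_compact_op T"
  proof (rule compact_op_limit[OF Tlin])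
    fix e :: real assume "e > 0"
    then obtain n where n: "\<And>x. norm (T x - op_apply (X n) x) \<le> e * norm x"
      using close by blast
    have "norm (T x - op_apply (X n) x) \<le> e" if "x \<in> cball 0 1" for x
    proof -
      have "e * norm x \<le> e * 1"
        using that \<open>e > 0\<close> by (intro mult_left_mono) auto
      then show ?thesis
        using n[of x] by simp
    qed
    then show "\<exists>A. is_compact_op A \<and> (\<forall>x\<in>cball 0 1. norm (T x - A x) \<le> e)"
      using op_apply by blast
  qed
  then obtain L where L: "op_apply L = T"
    using Abs_compact_op_inverse by blast
  have "X \<longlonglongrightarrow> L"
  proof (rule LIMSEQ_I)
    fix e :: real assume "e > 0"
    then obtain M where M: "\<And>n x. n \<ge> M \<Longrightarrow> norm (T x - op_apply (X n) x) \<le> e/2 * norm x"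
      using close[of "e/2"] by auto
    have "norm (X n - L) < e" if "n \<ge> M" for n
    proof -
      have "norm (L - X n) \<le> e/2"
        unfolding norm_compact_op.rep_eq minus_compact_op.rep_eq L
        by (rule onorm_bound) (use M[OF that] \<open>e > 0\<close> in auto)
      then show ?thesis
        using \<open>e > 0\<close> by (simp add: norm_minus_commute)
    qed
    then show "\<exists>no. \<forall>n\<ge>no. norm (X n - L) < e"
      by blast
  qed
  then show ?thesis
    by (auto simp: convergent_def)
qed

instance compact_op :: (complex_banach) complex_banach_algebra
  by standard (rule compact_op_complete)


section \<open>The algebraic tensor product\<close>

text \<open>A multiset of pairs stands for the formal sum of the elementary tensors of its members. The
  tensor product over the complex numbers is the quotient of the free commutative monoid of these
  formal sums by the congruence generated by bilinearity; it has negatives, since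
  \<open>(-x) \<otimes> y\<close> is the negative of \<open>x \<otimes> y\<close>.\<close>

inductive tensor_eq :: "('a::complex_vector \<times> 'b::complex_vector) multiset \<Rightarrow> ('a \<times> 'b) multiset \<Rightarrow> bool"
  where
    refl: "tensor_eq M M"
  | sym: "tensor_eq M N \<Longrightarrow> tensor_eq N M"
  | trans: "tensor_eq M N \<Longrightarrow> tensor_eq N K \<Longrightarrow> tensor_eq M K"
  | cong: "tensor_eq M N \<Longrightarrow> tensor_eq (M + K) (N + K)"
  | add_left: "tensor_eq {#(x + x', y)#} {#(x, y), (x', y)#}"
  | add_right: "tensor_eq {#(x, y + y')#} {#(x, y), (x, y')#}"
  | scale: "tensor_eq {#(c *\<^sub>C x, y)#} {#(x, c *\<^sub>C y)#}"
  | zero: "tensor_eq {#(0, y)#} {#}"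

lemma tensor_eq_plus:
  assumes "tensor_eq M M'" "tensor_eq N N'"
  shows "tensor_eq (M + N) (M' + N')"
  using tensor_eq.trans[OF tensor_eq.cong[OF assms(1), of N] ]
    tensor_eq.cong[OF assms(2), of M'] by (simp add: add.commute)

lemma tensor_eq_sum:
  "(\<And>p. p \<in># M \<Longrightarrow> tensor_eq (f p) (g p)) \<Longrightarrow> tensor_eq (\<Sum>p\<in>#M. f p) (\<Sum>p\<in>#M. g p)"
  by (induction M) (auto intro: tensor_eq_plus tensor_eq.refl)

lemma tensor_eq_image:
  assumes h: "\<And>x x' y. tensor_eq {#h (x + x', y)#} {#h (x, y), h (x', y)#}"
    "\<And>x y y'. tensor_eq {#h (x, y + y')#} {#h (x, y), h (x, y')#}"
    "\<And>c x y. tensor_eq {#h (c *\<^sub>C x, y)#} {#h (x, c *\<^sub>C y)#}"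
    "\<And>y. tensor_eq {#h (0, y)#} {#}"
  shows "tensor_eq M N \<Longrightarrow> tensor_eq (image_mset h M) (image_mset h N)"
  by (induction rule: tensor_eq.induct) (auto intro: tensor_eq.intros h)

lemma tensor_eq_zero_right: "tensor_eq {#(x, 0)#} {#}"
  using tensor_eq.scale[of 0 x 0] tensor_eq.zero[of 0] by (auto intro: tensor_eq.intros)

quotient_type (overloaded) ('a, 'b) tensor =
    "('a::complex_vector \<times> 'b::complex_vector) multiset" / tensor_eq
  by (rule equivpI) (auto simp: reflp_def symp_def transp_def intro: tensor_eq.intros)

lift_definition tens :: "'a::complex_vector \<Rightarrow> 'b::complex_vector \<Rightarrow> ('a, 'b) tensor" (infix \<open>\<otimes>\<close> 68)
  is "\<lambda>x y. {#(x, y)#}" .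

instantiation tensor :: (complex_vector, complex_vector) complex_vector
begin

lift_definition zero_tensor :: "('a, 'b) tensor" is "{#}" .

lift_definition plus_tensor :: "('a, 'b) tensor \<Rightarrow> ('a, 'b) tensor \<Rightarrow> ('a, 'b) tensor"
  is "(+)" by (rule tensor_eq_plus)

lift_definition scaleC_tensor :: "complex \<Rightarrow> ('a, 'b) tensor \<Rightarrow> ('a, 'b) tensor"
  is "\<lambda>c. image_mset (\<lambda>(x, y). (c *\<^sub>C x, y))"
proof (rule tensor_eq_image)
  show "tensor_eq {#case (d *\<^sub>C x, y) of (x, y) \<Rightarrow> (c *\<^sub>C x, y)#}
      {#case (x, d *\<^sub>C y) of (x, y) \<Rightarrow> (c *\<^sub>C x, y)#}" for c d and x :: 'a and y :: 'b
    using tensor_eq.scale[of d "c *\<^sub>C x" y] by (simp add: scaleC_scaleC mult.commute)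
qed (auto simp: scaleC_add_right intro: tensor_eq.intros)

definition uminus_tensor :: "('a, 'b) tensor \<Rightarrow> ('a, 'b) tensor"
  where "uminus_tensor u = (-1) *\<^sub>C u"
definition minus_tensor :: "('a, 'b) tensor \<Rightarrow> ('a, 'b) tensor \<Rightarrow> ('a, 'b) tensor"
  where "minus_tensor u v = u + - v"
definition scaleR_tensor :: "real \<Rightarrow> ('a, 'b) tensor \<Rightarrow> ('a, 'b) tensor"
  where "scaleR_tensor r u = complex_of_real r *\<^sub>C u"

lemma tensor_add_assoc: "u + v + w = u + (v + w)"
  and tensor_add_commute: "u + v = v + u"
  and tensor_add_0: "0 + u = u"
  for u v w :: "('a, 'b) tensor"
  by (transfer, simp add: ac_simps tensor_eq.refl)+

lemma tensor_add_left_commute: "u + (v + w) = v + (u + w)" for u v w :: "('a, 'b) tensor"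
  by (metis tensor_add_assoc tensor_add_commute)

lemma tensor_induct [case_names zero add]:
  assumes "P 0" "\<And>x y u. P u \<Longrightarrow> P (x \<otimes> y + u)"
  shows "P u"
proof (induction u rule: tensor.abs_induct)
  case (1 M)
  show ?case
  proof (induction M)
    case empty
    then show ?case
      using assms(1) by (simp add: zero_tensor_def)
  next
    case (add p M)
    have "abs_tensor (add_mset p M) = fst p \<otimes> snd p + abs_tensor M"
      by (simp add: tens.abs_eq plus_tensor.abs_eq)
    then show ?case
      using assms(2)[OF add] by simp
  qed
qed

lemma tens_add_left: "(x + x') \<otimes> y = x \<otimes> y + x' \<otimes> y"
  and tens_add_right: "x \<otimes> (y + y') = x \<otimes> y + x \<otimes> y'"
  and tens_zero_left: "0 \<otimes> y = 0"
  and tens_scaleC_swap: "(c *\<^sub>C x) \<otimes> y = x \<otimes> (c *\<^sub>C y)"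
  and tens_scaleC_left: "(c *\<^sub>C x) \<otimes> y = c *\<^sub>C (x \<otimes> y)"
  for x x' :: 'a and y y' :: 'b
  by (transfer, auto intro: tensor_eq.intros simp: add_mset_commute)+

lemma tensor_scaleC_add: "c *\<^sub>C (u + v) = c *\<^sub>C u + c *\<^sub>C v"
  and tensor_scaleC_0: "c *\<^sub>C 0 = (0 :: ('a, 'b) tensor)"
  for u v :: "('a, 'b) tensor"
  by (transfer, simp add: tensor_eq.refl)+

lemma tensor_scaleC_one: "1 *\<^sub>C u = u" for u :: "('a, 'b) tensor"
  by (induction u rule: tensor_induct)
    (simp_all add: tensor_scaleC_0 tensor_scaleC_add flip: tens_scaleC_left)

lemma tensor_scaleC_add_left: "(c + d) *\<^sub>C u = c *\<^sub>C u + d *\<^sub>C u" for u :: "('a, 'b) tensor"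
proof (induction u rule: tensor_induct)
  case zero
  then show ?case
    by (simp add: tensor_scaleC_0 tensor_add_0)
next
  case (add x y u)
  have "(c + d) *\<^sub>C (x \<otimes> y) = c *\<^sub>C (x \<otimes> y) + d *\<^sub>C (x \<otimes> y)"
    by (simp add: scaleC_add_left tens_add_left flip: tens_scaleC_left)
  then show ?case
    by (simp add: tensor_scaleC_add add tensor_add_assoc tensor_add_left_commute)
qed

lemma tensor_scaleC_scaleC: "c *\<^sub>C d *\<^sub>C u = (c * d) *\<^sub>C u" for u :: "('a, 'b) tensor"
  by (induction u rule: tensor_induct)
    (simp_all add: tensor_scaleC_0 tensor_scaleC_add scaleC_scaleC flip: tens_scaleC_left)

lemma tensor_scaleC_zero: "0 *\<^sub>C u = 0" for u :: "('a, 'b) tensor"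
  by (induction u rule: tensor_induct)
    (simp_all add: tensor_scaleC_0 tensor_scaleC_add tens_zero_left tensor_add_0 flip: tens_scaleC_left)

instance
proof
  fix u v w :: "('a, 'b) tensor" and a b :: complex and r s :: real
  show "u + v + w = u + (v + w)" "u + v = v + u" "0 + u = u"
    by (rule tensor_add_assoc tensor_add_commute tensor_add_0)+
  show "- u + u = 0"
    using tensor_scaleC_add_left[of "-1" 1 u]
    by (simp add: uminus_tensor_def tensor_scaleC_one tensor_scaleC_zero)
  show "u - v = u + - v"
    by (simp add: minus_tensor_def)
qed (simp_all add: scaleR_tensor_def tensor_scaleC_add tensor_scaleC_add_left tensor_scaleC_scaleC
    tensor_scaleC_one)

end

instantiation tensor :: (complex_algebra, complex_algebra) complex_algebra
begin

lift_definition times_tensor :: "('a, 'b) tensor \<Rightarrow> ('a, 'b) tensor \<Rightarrow> ('a, 'b) tensor"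
  is "\<lambda>M N. \<Sum>p\<in>#M. \<Sum>q\<in>#N. {#(fst p * fst q, snd p * snd q)#}"
proof -
  fix M M' N N' :: "('a \<times> 'b) multiset"
  let ?m = "\<lambda>M N. \<Sum>p\<in>#M. \<Sum>q\<in>#N. {#(fst p * fst q, snd p * snd q)#}"
  assume M: "tensor_eq M M'" and N: "tensor_eq N N'"
  have image: "(\<Sum>q\<in>#N. {#(fst p * fst q, snd p * snd q)#})
      = image_mset (\<lambda>q. (fst p * fst q, snd p * snd q)) N" for p and N :: "('a \<times> 'b) multiset"
    by (induction N) auto
  have image': "(\<Sum>p\<in>#M. {#(fst p * fst q, snd p * snd q)#})
      = image_mset (\<lambda>p. (fst p * fst q, snd p * snd q)) M" for q and M :: "('a \<times> 'b) multiset"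
    by (induction M) auto
  have zero_right: "tensor_eq {#(x :: 'a, 0 :: 'b)#} {#}" for x
    by (rule tensor_eq_zero_right)
  have "tensor_eq (?m M N) (?m M N')"
    unfolding image
    by (intro tensor_eq_sum tensor_eq_image N)
      (auto simp: distrib_left mult_scaleC_right intro: tensor_eq.intros)
  moreover have "tensor_eq (?m M N') (?m M' N')"
    unfolding sum_mset.swap[of _ N'] image'
    by (intro tensor_eq_sum tensor_eq_image M)
      (auto simp: distrib_right mult_scaleC_left intro: tensor_eq.intros)
  ultimately show "tensor_eq (?m M N) (?m M' N')"
    by (rule tensor_eq.trans)
qed

lemma tens_mult: "(x \<otimes> y) * (x' \<otimes> y') = (x * x') \<otimes> (y * y')" for x x' :: 'a and y y' :: 'b
  by transfer (simp add: tensor_eq.refl)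

lemma tensor_distrib: "(u + v) * w = u * w + v * w" "u * (v + w) = u * v + u * w"
  for u v w :: "('a, 'b) tensor"
  by (transfer, simp add: sum_mset.distrib tensor_eq.refl)+

lemma tensor_mult_zero: "0 * u = 0" "u * 0 = 0" for u :: "('a, 'b) tensor"
  by (transfer, simp add: tensor_eq.refl)+

instance
proof
  fix u v w :: "('a, 'b) tensor" and a :: complex and r :: real
  show "(u + v) * w = u * w + v * w" "u * (v + w) = u * v + u * w"
    by (rule tensor_distrib)+
  have 1: "(x \<otimes> y) * (x' \<otimes> y') * w = (x \<otimes> y) * ((x' \<otimes> y') * w)" for x x' y y'
    by (induction w rule: tensor_induct)
      (simp_all add: tensor_mult_zero tensor_distrib tens_mult mult.assoc)
  have 2: "(x \<otimes> y) * v * w = (x \<otimes> y) * (v * w)" for x y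
    by (induction v rule: tensor_induct) (simp_all add: tensor_mult_zero tensor_distrib 1)
  show "u * v * w = u * (v * w)"
    by (induction u rule: tensor_induct) (simp_all add: tensor_mult_zero tensor_distrib 2)
  have l1: "(a *\<^sub>C (x \<otimes> y)) * v = a *\<^sub>C ((x \<otimes> y) * v)" for a x y
    by (induction v rule: tensor_induct)
      (simp_all add: tensor_mult_zero tensor_distrib tens_mult scaleC_add_right mult_scaleC_left
        flip: tens_scaleC_left)
  show left: "(a *\<^sub>C u) * v = a *\<^sub>C (u * v)" for a
    by (induction u rule: tensor_induct)
      (simp_all add: tensor_mult_zero tensor_distrib scaleC_add_right l1)
  have r1: "(x \<otimes> y) * (a *\<^sub>C v) = a *\<^sub>C ((x \<otimes> y) * v)" for a x y
    by (induction v rule: tensor_induct)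
      (simp_all add: tensor_mult_zero tensor_distrib tens_mult scaleC_add_right mult_scaleC_right
        flip: tens_scaleC_left)
  show right: "u * (a *\<^sub>C v) = a *\<^sub>C (u * v)" for a
    by (induction u rule: tensor_induct)
      (simp_all add: tensor_mult_zero tensor_distrib scaleC_add_right r1)
  show "(r *\<^sub>R u) * v = r *\<^sub>R (u * v)" "u * (r *\<^sub>R v) = r *\<^sub>R (u * v)"
    by (simp_all add: left right flip: scaleC_of_real)
qed

end


section \<open>The projective tensor norm\<close>

definition gamma_norm :: "('a::complex_normed_vector, 'b::complex_normed_vector) tensor \<Rightarrow> real"
  where "gamma_norm u = Inf {(\<Sum>(x, y)\<in>#M. norm x * norm y) | M. u = (\<Sum>(x, y)\<in>#M. x \<otimes> y)}"

lemma tensor_rep: "\<exists>M. u = (\<Sum>(x, y)\<in>#M. x \<otimes> y)"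
proof (induction u rule: tensor_induct)
  case zero
  show ?case
    by (rule exI[of _ "{#}"]) simp
next
  case (add x y u)
  then obtain M where "u = (\<Sum>(x, y)\<in>#M. x \<otimes> y)"
    by blast
  then show ?case
    by (intro exI[of _ "add_mset (x, y) M"]) simp
qed

lemma weight_nonneg: "0 \<le> (\<Sum>(x, y)\<in>#M. norm x * norm y)"
  by (induction M) auto

lemma gamma_bdd: "bdd_below {(\<Sum>(x, y)\<in>#M. norm x * norm y) | M. u = (\<Sum>(x, y)\<in>#M. x \<otimes> y)}"
  by (rule bdd_belowI[of _ 0]) (auto simp: weight_nonneg)

lemma gamma_le: "u = (\<Sum>(x, y)\<in>#M. x \<otimes> y) \<Longrightarrow> gamma_norm u \<le> (\<Sum>(x, y)\<in>#M. norm x * norm y)"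
  unfolding gamma_norm_def by (rule cInf_lower[OF _ gamma_bdd]) blast

lemma gamma_approx:
  assumes "e > 0"
  obtains M where "u = (\<Sum>(x, y)\<in>#M. x \<otimes> y)" "(\<Sum>(x, y)\<in>#M. norm x * norm y) < gamma_norm u + e"
proof -
  let ?S = "{(\<Sum>(x, y)\<in>#M. norm x * norm y) | M. u = (\<Sum>(x, y)\<in>#M. x \<otimes> y)}"
  have "?S \<noteq> {}"
    using tensor_rep[of u] by blast
  then have "\<exists>t\<in>?S. t < gamma_norm u + e"
    using cInf_lessD[of ?S "gamma_norm u + e"] assms by (auto simp: gamma_norm_def)
  then show ?thesis
    using that by blast
qed

lemma gamma_nonneg: "0 \<le> gamma_norm u"
  unfolding gamma_norm_def
  by (rule cInf_greatest) (use tensor_rep[of u] in \<open>auto simp: weight_nonneg\<close>)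

lemma gamma_tens_le: "gamma_norm (x \<otimes> y) \<le> norm x * norm y"
  using gamma_le[of "x \<otimes> y" "{#(x, y)#}"] by simp

lemma gamma_zero [simp]: "gamma_norm 0 = 0"
proof (rule antisym)
  show "gamma_norm 0 \<le> 0"
    using gamma_le[of 0 "{#}"] by simp
qed (rule gamma_nonneg)

lemma gamma_triangle: "gamma_norm (u + v) \<le> gamma_norm u + gamma_norm v"
proof (rule field_le_epsilon)
  fix e :: real assume "e > 0"
  then have e: "e/2 > 0" by simp
  obtain M where M: "u = (\<Sum>(x, y)\<in>#M. x \<otimes> y)" "(\<Sum>(x, y)\<in>#M. norm x * norm y) < gamma_norm u + e/2"
    using gamma_approx[OF e] .
  obtain N where N: "v = (\<Sum>(x, y)\<in>#N. x \<otimes> y)" "(\<Sum>(x, y)\<in>#N. norm x * norm y) < gamma_norm v + e/2"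
    using gamma_approx[OF e] .
  have "gamma_norm (u + v) \<le> (\<Sum>(x, y)\<in>#M + N. norm x * norm y)"
    by (rule gamma_le) (simp add: M N)
  then show "gamma_norm (u + v) \<le> gamma_norm u + gamma_norm v + e"
    using M(2) N(2) by simp
qed

lemma gamma_scaleC_le: "gamma_norm (c *\<^sub>C u) \<le> cmod c * gamma_norm u"
proof (rule field_le_epsilon)
  fix e :: real assume "e > 0"
  then have e: "e / (cmod c + 1) > 0"
    by (simp add: add_nonneg_pos)
  obtain M where M: "u = (\<Sum>(x, y)\<in>#M. x \<otimes> y)"
    "(\<Sum>(x, y)\<in>#M. norm x * norm y) < gamma_norm u + e / (cmod c + 1)"
    using gamma_approx[OF e] .
  have "gamma_norm (c *\<^sub>C u) \<le> (\<Sum>(x, y)\<in>#image_mset (\<lambda>(x, y). (c *\<^sub>C x, y)) M. norm x * norm y)"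
  proof (rule gamma_le)
    show "c *\<^sub>C u = (\<Sum>(x, y)\<in>#image_mset (\<lambda>(x, y). (c *\<^sub>C x, y)) M. x \<otimes> y)"
      unfolding M(1) by (induction M) (auto simp: scaleC_add_right tens_scaleC_left)
  qed
  also have "\<dots> = cmod c * (\<Sum>(x, y)\<in>#M. norm x * norm y)"
    by (induction M) (auto simp: norm_scaleC algebra_simps)
  also have "\<dots> \<le> cmod c * (gamma_norm u + e / (cmod c + 1))"
    using M(2) by (intro mult_left_mono) auto
  also have "\<dots> = cmod c * gamma_norm u + cmod c / (cmod c + 1) * e"
    by (simp add: algebra_simps)
  also have "\<dots> \<le> cmod c * gamma_norm u + 1 * e"
    using \<open>e > 0\<close> by (intro add_left_mono mult_right_mono) (auto simp: divide_le_eq_1 add_nonneg_pos)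
  finally show "gamma_norm (c *\<^sub>C u) \<le> cmod c * gamma_norm u + e"
    by simp
qed

lemma gamma_uminus [simp]: "gamma_norm (- u) = gamma_norm u"
  using gamma_scaleC_le[of "-1" u] gamma_scaleC_le[of "-1" "- u"] by (simp add: scaleC_minus1)

lemma gamma_minus_commute: "gamma_norm (u - v) = gamma_norm (v - u)"
  using gamma_uminus[of "u - v"] by simp

lemma gamma_scaleC: "gamma_norm (c *\<^sub>C u) = cmod c * gamma_norm u"
proof (cases "c = 0")
  case False
  have "gamma_norm u \<le> cmod (inverse c) * gamma_norm (c *\<^sub>C u)"
    using gamma_scaleC_le[of "inverse c" "c *\<^sub>C u"] False by (simp add: scaleC_scaleC)
  then show ?thesis
    using False gamma_scaleC_le[of c u] by (simp add: norm_divide field_simps)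
qed simp

lemma gamma_mult_le:
  fixes u v :: "('a::complex_normed_algebra, 'b::complex_normed_algebra) tensor"
  shows "gamma_norm (u * v) \<le> gamma_norm u * gamma_norm v"
proof -
  have le: "gamma_norm (u * v) \<le> (\<Sum>(x, y)\<in>#M. norm x * norm y) * (\<Sum>(x, y)\<in>#N. norm x * norm y)"
    if u: "u = (\<Sum>(x, y)\<in>#M. x \<otimes> y)" and v: "v = (\<Sum>(x, y)\<in>#N. x \<otimes> y)" for u v :: "('a, 'b) tensor" and M N
    using u
  proof (induction M arbitrary: u)
    case (add p M)
    obtain x y where p: "p = (x, y)"
      by (cases p)
    have "gamma_norm ((x \<otimes> y) * v) \<le> norm x * norm y * (\<Sum>(x, y)\<in>#N. norm x * norm y)"
      using v
    proof (induction N arbitrary: v)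
      case (add q N)
      obtain x' y' where q: "q = (x', y')"
        by (cases q)
      define w where "w = (\<Sum>(x, y)\<in>#N. x \<otimes> y)"
      have "gamma_norm ((x * x') \<otimes> (y * y')) \<le> norm (x * x') * norm (y * y')"
        by (rule gamma_tens_le)
      also have "\<dots> \<le> (norm x * norm x') * (norm y * norm y')"
        by (intro mult_mono norm_mult_ineq) auto
      finally have "gamma_norm ((x * x') \<otimes> (y * y')) \<le> norm x * norm y * (norm x' * norm y')"
        by (simp add: mult_ac)
      moreover have "gamma_norm ((x \<otimes> y) * w) \<le> norm x * norm y * (\<Sum>(x, y)\<in>#N. norm x * norm y)"
        by (rule add.IH) (simp add: w_def)
      moreover have "(x \<otimes> y) * v = (x * x') \<otimes> (y * y') + (x \<otimes> y) * w"
        by (simp add: add.prems q w_def distrib_left tens_mult)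
      ultimately show ?case
        using gamma_triangle[of "(x * x') \<otimes> (y * y')" "(x \<otimes> y) * w"] by (simp add: q distrib_left)
    qed simp
    moreover define w where "w = (\<Sum>(x, y)\<in>#M. x \<otimes> y)"
    moreover have "gamma_norm (w * v) \<le> (\<Sum>(x, y)\<in>#M. norm x * norm y) * (\<Sum>(x, y)\<in>#N. norm x * norm y)"
      by (rule add.IH) (simp add: w_def)
    moreover have "u * v = (x \<otimes> y) * v + w * v"
      by (simp add: add.prems p w_def distrib_right)
    ultimately show ?case
      using gamma_triangle[of "(x \<otimes> y) * v" "w * v"] by (simp add: p distrib_right)
  qed simp
  show ?thesis
  proof (rule tendsto_lowerbound)
    show "((\<lambda>e. (gamma_norm u + e) * (gamma_norm v + e)) \<longlongrightarrow> gamma_norm u * gamma_norm v) (at_right 0)"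
      by (rule tendsto_eq_intros tendsto_ident_at | simp)+
    show "\<forall>\<^sub>F e in at_right 0. gamma_norm (u * v) \<le> (gamma_norm u + e) * (gamma_norm v + e)"
      using eventually_at_right_less[of 0]
    proof eventually_elim
      case (elim e)
      obtain M where M: "u = (\<Sum>(x, y)\<in>#M. x \<otimes> y)" "(\<Sum>(x, y)\<in>#M. norm x * norm y) < gamma_norm u + e"
        using gamma_approx[OF elim] .
      obtain N where N: "v = (\<Sum>(x, y)\<in>#N. x \<otimes> y)" "(\<Sum>(x, y)\<in>#N. norm x * norm y) < gamma_norm v + e"
        using gamma_approx[OF elim] .
      have "(\<Sum>(x, y)\<in>#M. norm x * norm y) * (\<Sum>(x, y)\<in>#N. norm x * norm y)
          \<le> (gamma_norm u + e) * (gamma_norm v + e)"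
        using M(2) N(2) elim by (intro mult_mono) (auto simp: weight_nonneg gamma_nonneg add_nonneg_pos less_imp_le)
      then show ?case
        using le[OF M(1) N(1)] by linarith
    qed
  qed simp
qed


section \<open>The projective tensor product\<close>

text \<open>The completion of the algebraic tensor product: Cauchy sequences modulo null sequences.\<close>

definition gamma_Cauchy :: "(nat \<Rightarrow> ('a::complex_normed_vector, 'b::complex_normed_vector) tensor) \<Rightarrow> bool"
  where "gamma_Cauchy X \<longleftrightarrow> (\<forall>e>0. \<exists>N. \<forall>m\<ge>N. \<forall>n\<ge>N. gamma_norm (X m - X n) < e)"

definition gamma_equiv ::
    "(nat \<Rightarrow> ('a::complex_normed_vector, 'b::complex_normed_vector) tensor) \<Rightarrow> (nat \<Rightarrow> ('a, 'b) tensor) \<Rightarrow> bool"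
  where "gamma_equiv X Y \<longleftrightarrow>
    gamma_Cauchy X \<and> gamma_Cauchy Y \<and> (\<lambda>n. gamma_norm (X n - Y n)) \<longlonglongrightarrow> 0"

lemma gamma_Cauchy_iff:
  "gamma_Cauchy X \<longleftrightarrow> ((\<lambda>p. gamma_norm (X (fst p) - X (snd p))) \<longlongrightarrow> 0) (sequentially \<times>\<^sub>F sequentially)"
proof
  assume X: "gamma_Cauchy X"
  show "((\<lambda>p. gamma_norm (X (fst p) - X (snd p))) \<longlongrightarrow> 0) (sequentially \<times>\<^sub>F sequentially)"
    unfolding tendsto_iff
  proof (intro allI impI)
    fix e :: real assume "e > 0"
    then obtain N where "\<forall>m\<ge>N. \<forall>n\<ge>N. gamma_norm (X m - X n) < e"
      using X unfolding gamma_Cauchy_def by blast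
    then show "\<forall>\<^sub>F p in sequentially \<times>\<^sub>F sequentially. dist (gamma_norm (X (fst p) - X (snd p))) 0 < e"
      by (auto simp: eventually_prod_sequentially dist_real_def gamma_nonneg)
  qed
next
  assume "((\<lambda>p. gamma_norm (X (fst p) - X (snd p))) \<longlongrightarrow> 0) (sequentially \<times>\<^sub>F sequentially)"
  then show "gamma_Cauchy X"
    by (auto simp: tendsto_iff eventually_prod_sequentially dist_real_def gamma_nonneg gamma_Cauchy_def)
      blast
qed

lemma gamma_squeeze:
  "(\<And>x. gamma_norm (f x) \<le> g x) \<Longrightarrow> (g \<longlongrightarrow> 0) F \<Longrightarrow> ((\<lambda>x. gamma_norm (f x)) \<longlongrightarrow> 0) F"
  by (rule tendsto_sandwich[of "\<lambda>_. 0" _ _ g]) (auto simp: gamma_nonneg)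

lemma gamma_triangle_minus: "gamma_norm (u - w) \<le> gamma_norm (u - v) + gamma_norm (v - w)"
  using gamma_triangle[of "u - v" "v - w"] by simp

lemma gamma_add_diff: "gamma_norm ((u + v) - (u' + v')) \<le> gamma_norm (u - u') + gamma_norm (v - v')"
  using gamma_triangle[of "u - u'" "v - v'"] by (simp add: algebra_simps)

lemma gamma_abs_diff: "\<bar>gamma_norm u - gamma_norm v\<bar> \<le> gamma_norm (u - v)"
  using gamma_triangle[of "u - v" v] gamma_triangle[of "v - u" u] gamma_minus_commute[of u v] by simp

lemma gamma_mult_diff:
  fixes u v :: "('a::complex_normed_algebra, 'b::complex_normed_algebra) tensor"
  shows "gamma_norm (u * v - u' * v') \<le> gamma_norm (u - u') * gamma_norm v + gamma_norm u' * gamma_norm (v - v')"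
proof -
  have "u * v - u' * v' = (u - u') * v + u' * (v - v')"
    by (simp add: algebra_simps)
  then show ?thesis
    using gamma_triangle[of "(u - u') * v" "u' * (v - v')"] gamma_mult_le[of "u - u'" v]
      gamma_mult_le[of u' "v - v'"] by simp
qed

lemma gamma_Cauchy_const: "gamma_Cauchy (\<lambda>n. u)"
  by (simp add: gamma_Cauchy_def)

lemma gamma_Cauchy_add: "gamma_Cauchy X \<Longrightarrow> gamma_Cauchy Y \<Longrightarrow> gamma_Cauchy (\<lambda>n. X n + Y n)"
  unfolding gamma_Cauchy_iff
  by (rule gamma_squeeze[OF gamma_add_diff]) (auto intro: tendsto_add_zero)

lemma gamma_Cauchy_scaleC: "gamma_Cauchy X \<Longrightarrow> gamma_Cauchy (\<lambda>n. c *\<^sub>C X n)"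
  unfolding gamma_Cauchy_iff
  by (simp add: gamma_scaleC tendsto_mult_right_zero flip: scaleC_diff_right)

lemma gamma_Cauchy_convergent:
  assumes "gamma_Cauchy X"
  shows "convergent (\<lambda>n. gamma_norm (X n))"
proof (rule Cauchy_convergent, rule metric_CauchyI)
  fix e :: real assume "e > 0"
  then obtain N where "\<forall>m\<ge>N. \<forall>n\<ge>N. gamma_norm (X m - X n) < e"
    using assms unfolding gamma_Cauchy_def by blast
  then show "\<exists>N. \<forall>m\<ge>N. \<forall>n\<ge>N. dist (gamma_norm (X m)) (gamma_norm (X n)) < e"
    unfolding dist_real_def using gamma_abs_diff le_less_trans by blast
qed

lemma gamma_Cauchy_bounded:
  assumes "gamma_Cauchy X"
  obtains B where "\<And>n. gamma_norm (X n) \<le> B" "B \<ge> 0"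
proof -
  have "Bseq (\<lambda>n. gamma_norm (X n))"
    using gamma_Cauchy_convergent[OF assms] by (rule convergent_imp_Bseq)
  then obtain K where "\<And>n. norm (gamma_norm (X n)) \<le> K"
    by (auto simp: Bseq_def)
  then have "gamma_norm (X n) \<le> K" for n
    by (simp add: gamma_nonneg)
  moreover from this have "K \<ge> 0"
    using gamma_nonneg order_trans by blast
  ultimately show ?thesis
    using that by blast
qed

lemma gamma_Cauchy_mult:
  fixes X :: "nat \<Rightarrow> ('a::complex_normed_algebra, 'b::complex_normed_algebra) tensor"
  assumes X: "gamma_Cauchy X" and Y: "gamma_Cauchy Y"
  shows "gamma_Cauchy (\<lambda>n. X n * Y n)"
proof -
  obtain B where B: "\<And>n. gamma_norm (X n) \<le> B" "B \<ge> 0"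
    using gamma_Cauchy_bounded[OF X] by blast
  obtain C where C: "\<And>n. gamma_norm (Y n) \<le> C" "C \<ge> 0"
    using gamma_Cauchy_bounded[OF Y] by blast
  show ?thesis
    unfolding gamma_Cauchy_iff
  proof (rule gamma_squeeze)
    show "gamma_norm (X (fst p) * Y (fst p) - X (snd p) * Y (snd p))
        \<le> gamma_norm (X (fst p) - X (snd p)) * C + B * gamma_norm (Y (fst p) - Y (snd p))" for p
      by (rule order_trans[OF gamma_mult_diff add_mono])
        (auto intro: mult_left_mono mult_right_mono B C gamma_nonneg)
    show "((\<lambda>p. gamma_norm (X (fst p) - X (snd p)) * C + B * gamma_norm (Y (fst p) - Y (snd p))) \<longlongrightarrow> 0)
        (sequentially \<times>\<^sub>F sequentially)"
      using X Y unfolding gamma_Cauchy_iff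
      by (auto intro!: tendsto_add_zero tendsto_mult_left_zero tendsto_mult_right_zero)
  qed
qed

quotient_type (overloaded) ('a, 'b) ptensor =
    "nat \<Rightarrow> ('a::complex_normed_vector, 'b::complex_normed_vector) tensor" / partial: gamma_equiv
proof (rule part_equivpI)
  show "\<exists>X. gamma_equiv X X"
    by (rule exI[of _ "\<lambda>n. 0"]) (simp add: gamma_equiv_def gamma_Cauchy_const)
  show "symp gamma_equiv"
    by (auto simp: symp_def gamma_equiv_def gamma_minus_commute)
  show "transp gamma_equiv"
    unfolding transp_def gamma_equiv_def
    by (auto intro: gamma_squeeze[OF gamma_triangle_minus] tendsto_add_zero)
qed

lemma gamma_equiv_refl: "gamma_equiv X X \<longleftrightarrow> gamma_Cauchy X"
  by (simp add: gamma_equiv_def)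

lemma gamma_equiv_add:
  assumes "gamma_equiv X X'" "gamma_equiv Y Y'"
  shows "gamma_equiv (\<lambda>n. X n + Y n) (\<lambda>n. X' n + Y' n)"
  using assms unfolding gamma_equiv_def
  by (auto intro: gamma_Cauchy_add gamma_squeeze[OF gamma_add_diff] tendsto_add_zero)

lemma gamma_equiv_scaleC: "gamma_equiv X X' \<Longrightarrow> gamma_equiv (\<lambda>n. c *\<^sub>C X n) (\<lambda>n. c *\<^sub>C X' n)"
  unfolding gamma_equiv_def
  by (auto simp: gamma_Cauchy_scaleC gamma_scaleC tendsto_mult_right_zero simp flip: scaleC_diff_right)

lemma gamma_equiv_mult:
  fixes X :: "nat \<Rightarrow> ('a::complex_normed_algebra, 'b::complex_normed_algebra) tensor"
  assumes X: "gamma_equiv X X'" and Y: "gamma_equiv Y Y'"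
  shows "gamma_equiv (\<lambda>n. X n * Y n) (\<lambda>n. X' n * Y' n)"
proof -
  obtain B where B: "\<And>n. gamma_norm (X' n) \<le> B" "B \<ge> 0"
    using gamma_Cauchy_bounded X unfolding gamma_equiv_def by blast
  obtain C where C: "\<And>n. gamma_norm (Y n) \<le> C" "C \<ge> 0"
    using gamma_Cauchy_bounded Y unfolding gamma_equiv_def by blast
  have "(\<lambda>n. gamma_norm (X n * Y n - X' n * Y' n)) \<longlonglongrightarrow> 0"
  proof (rule gamma_squeeze)
    show "gamma_norm (X n * Y n - X' n * Y' n)
        \<le> gamma_norm (X n - X' n) * C + B * gamma_norm (Y n - Y' n)" for n
      by (rule order_trans[OF gamma_mult_diff add_mono])
        (auto intro: mult_left_mono mult_right_mono B C gamma_nonneg)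
    show "(\<lambda>n. gamma_norm (X n - X' n) * C + B * gamma_norm (Y n - Y' n)) \<longlonglongrightarrow> 0"
      using X Y unfolding gamma_equiv_def
      by (auto intro!: tendsto_add_zero tendsto_mult_left_zero tendsto_mult_right_zero)
  qed
  then show ?thesis
    using X Y by (simp add: gamma_equiv_def gamma_Cauchy_mult)
qed

lemma gamma_equiv_lim:
  assumes "gamma_equiv X Y"
  shows "lim (\<lambda>n. gamma_norm (X n)) = lim (\<lambda>n. gamma_norm (Y n))"
proof -
  have X: "(\<lambda>n. gamma_norm (X n)) \<longlonglongrightarrow> lim (\<lambda>n. gamma_norm (X n))"
    and Y: "(\<lambda>n. gamma_norm (Y n)) \<longlonglongrightarrow> lim (\<lambda>n. gamma_norm (Y n))"
    and XY: "(\<lambda>n. gamma_norm (X n - Y n)) \<longlonglongrightarrow> 0"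
    using assms gamma_Cauchy_convergent by (auto simp: gamma_equiv_def convergent_LIMSEQ_iff)
  have "(\<lambda>n. gamma_norm (X n) - gamma_norm (Y n)) \<longlonglongrightarrow> 0"
    by (rule Lim_null_comparison[OF _ XY]) (simp add: gamma_abs_diff)
  from LIMSEQ_unique[OF this tendsto_diff[OF X Y]] show ?thesis
    by simp
qed

instantiation ptensor :: (complex_normed_vector, complex_normed_vector) complex_normed_vector
begin

lift_definition zero_ptensor :: "('a, 'b) ptensor" is "\<lambda>n. 0"
  by (simp add: gamma_equiv_refl gamma_Cauchy_const)
lift_definition plus_ptensor :: "('a, 'b) ptensor \<Rightarrow> ('a, 'b) ptensor \<Rightarrow> ('a, 'b) ptensor"
  is "\<lambda>X Y n. X n + Y n" by (rule gamma_equiv_add)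
lift_definition scaleC_ptensor :: "complex \<Rightarrow> ('a, 'b) ptensor \<Rightarrow> ('a, 'b) ptensor"
  is "\<lambda>c X n. c *\<^sub>C X n" by (rule gamma_equiv_scaleC)
lift_definition norm_ptensor :: "('a, 'b) ptensor \<Rightarrow> real"
  is "\<lambda>X. lim (\<lambda>n. gamma_norm (X n))" by (rule gamma_equiv_lim)

definition uminus_ptensor :: "('a, 'b) ptensor \<Rightarrow> ('a, 'b) ptensor"
  where "uminus_ptensor u = (-1) *\<^sub>C u"
definition minus_ptensor :: "('a, 'b) ptensor \<Rightarrow> ('a, 'b) ptensor \<Rightarrow> ('a, 'b) ptensor"
  where "minus_ptensor u v = u + - v"
definition scaleR_ptensor :: "real \<Rightarrow> ('a, 'b) ptensor \<Rightarrow> ('a, 'b) ptensor"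
  where "scaleR_ptensor r u = complex_of_real r *\<^sub>C u"
definition dist_ptensor :: "('a, 'b) ptensor \<Rightarrow> ('a, 'b) ptensor \<Rightarrow> real"
  where "dist_ptensor u v = norm (u - v)"
definition sgn_ptensor :: "('a, 'b) ptensor \<Rightarrow> ('a, 'b) ptensor"
  where "sgn_ptensor u = inverse (norm u) *\<^sub>R u"
definition uniformity_ptensor :: "(('a, 'b) ptensor \<times> ('a, 'b) ptensor) filter"
  where "uniformity_ptensor = (INF e\<in>{0 <..}. principal {(x, y). dist x y < e})"
definition open_ptensor :: "('a, 'b) ptensor set \<Rightarrow> bool"
  where "open_ptensor U \<longleftrightarrow> (\<forall>x\<in>U. eventually (\<lambda>(x', y). x' = x \<longrightarrow> y \<in> U) uniformity)"

lemma norm_ptensor_tendsto: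
  assumes "gamma_Cauchy X"
  shows "(\<lambda>n. gamma_norm (X n)) \<longlonglongrightarrow> norm (abs_ptensor X)"
  using assms gamma_Cauchy_convergent[OF assms]
  by (simp add: norm_ptensor.abs_eq gamma_equiv_refl convergent_LIMSEQ_iff)

lemma ptensor_cases:
  obtains X where "u = abs_ptensor X" "gamma_Cauchy X"
  by (metis gamma_equiv_refl Quotient_ptensor Quotient_abs_rep Quotient_rep_reflp)

instance
proof
  fix u v w :: "('a, 'b) ptensor" and a b :: complex and r s :: real
  show "u + v + w = u + (v + w)" "u + v = v + u" "0 + u = u"
    by (transfer, simp add: ac_simps gamma_equiv_refl gamma_equiv_def gamma_Cauchy_add)+
  show "- u + u = 0"
    unfolding uminus_ptensor_def
    by transfer (simp add: gamma_equiv_def gamma_Cauchy_const scaleC_minus1)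
  show "u - v = u + - v"
    by (simp add: minus_ptensor_def)
  show "a *\<^sub>C (u + v) = a *\<^sub>C u + a *\<^sub>C v" "(a + b) *\<^sub>C u = a *\<^sub>C u + b *\<^sub>C u"
      "a *\<^sub>C b *\<^sub>C u = (a * b) *\<^sub>C u"
    by (transfer, simp add: scaleC_add_right scaleC_add_left scaleC_scaleC gamma_equiv_def
        gamma_Cauchy_add gamma_Cauchy_scaleC)+
  note C = this
  show "complex_of_real r *\<^sub>C u = r *\<^sub>R u"
    by (simp add: scaleR_ptensor_def)
  show "r *\<^sub>R (u + v) = r *\<^sub>R u + r *\<^sub>R v" "(r + s) *\<^sub>R u = r *\<^sub>R u + s *\<^sub>R u"
    "r *\<^sub>R s *\<^sub>R u = (r * s) *\<^sub>R u" "1 *\<^sub>R u = u"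
    unfolding scaleR_ptensor_def
    by (transfer, simp add: scaleC_add_right scaleC_add_left scaleC_scaleC gamma_equiv_def
        gamma_Cauchy_add gamma_Cauchy_scaleC)+
  show "dist u v = norm (u - v)" "sgn u = inverse (norm u) *\<^sub>R u"
    by (simp_all add: dist_ptensor_def sgn_ptensor_def)
  show "uniformity = (INF e\<in>{0 <..}. principal {(x :: ('a, 'b) ptensor, y). dist x y < e})"
    by (simp add: uniformity_ptensor_def)
  show "open U \<longleftrightarrow> (\<forall>x\<in>U. eventually (\<lambda>(x', y). x' = x \<longrightarrow> y \<in> U) uniformity)"
    for U :: "('a, 'b) ptensor set"
    by (simp add: open_ptensor_def)
  obtain X where X: "u = abs_ptensor X" "gamma_Cauchy X"
    by (rule ptensor_cases)
  obtain Y where Y: "v = abs_ptensor Y" "gamma_Cauchy Y"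
    by (rule ptensor_cases)
  show "norm (u + v) \<le> norm u + norm v"
  proof (rule LIMSEQ_le)
    show "(\<lambda>n. gamma_norm (X n + Y n)) \<longlonglongrightarrow> norm (u + v)"
      using norm_ptensor_tendsto[OF gamma_Cauchy_add[OF X(2) Y(2)]]
      by (simp add: X Y plus_ptensor.abs_eq gamma_equiv_refl)
    show "(\<lambda>n. gamma_norm (X n) + gamma_norm (Y n)) \<longlonglongrightarrow> norm u + norm v"
      unfolding X(1) Y(1) by (intro tendsto_add norm_ptensor_tendsto X Y)
  qed (auto intro: gamma_triangle)
  show scale: "norm (a *\<^sub>C u) = cmod a * norm u" for a
  proof (rule LIMSEQ_unique)
    show "(\<lambda>n. gamma_norm (a *\<^sub>C X n)) \<longlonglongrightarrow> norm (a *\<^sub>C u)"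
      using norm_ptensor_tendsto[OF gamma_Cauchy_scaleC[OF X(2)]]
      by (simp add: X scaleC_ptensor.abs_eq gamma_equiv_refl)
    show "(\<lambda>n. gamma_norm (a *\<^sub>C X n)) \<longlonglongrightarrow> cmod a * norm u"
      unfolding gamma_scaleC X(1) by (intro tendsto_mult_left norm_ptensor_tendsto X)
  qed
  show "norm (r *\<^sub>R u) = \<bar>r\<bar> * norm u"
    by (simp add: scaleR_ptensor_def scale)
  show "(norm u = 0) = (u = 0)"
  proof
    assume "norm u = 0"
    then have "gamma_equiv X (\<lambda>n. 0)"
      using norm_ptensor_tendsto[OF X(2)] X by (simp add: gamma_equiv_def gamma_Cauchy_const)
    then show "u = 0"
      unfolding X(1) zero_ptensor_def by (rule Quotient_rel_abs[OF Quotient_ptensor])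
  next
    assume "u = 0"
    then show "norm u = 0"
      by (simp add: zero_ptensor_def norm_ptensor.abs_eq gamma_equiv_refl gamma_Cauchy_const)
  qed
qed

end

definition ptensor_of :: "('a::complex_normed_vector, 'b::complex_normed_vector) tensor \<Rightarrow> ('a, 'b) ptensor"
  where "ptensor_of u = abs_ptensor (\<lambda>n. u)"

lemma norm_ptensor_of: "norm (ptensor_of u) = gamma_norm u"
  using norm_ptensor_tendsto[OF gamma_Cauchy_const, of u]
  by (simp add: ptensor_of_def LIMSEQ_const_iff)

lemma ptensor_of_add: "ptensor_of (u + v) = ptensor_of u + ptensor_of v"
  by (simp add: ptensor_of_def plus_ptensor.abs_eq gamma_equiv_refl gamma_Cauchy_const)

lemma ptensor_of_scaleC: "ptensor_of (c *\<^sub>C u) = c *\<^sub>C ptensor_of u"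
  by (simp add: ptensor_of_def scaleC_ptensor.abs_eq gamma_equiv_refl gamma_Cauchy_const)

lemma ptensor_of_diff: "ptensor_of (u - v) = ptensor_of u - ptensor_of v"
  using ptensor_of_add[of "u - v" v] by (simp add: eq_diff_eq)

lemma ptensor_of_tendsto:
  assumes X: "gamma_Cauchy X"
  shows "(\<lambda>n. ptensor_of (X n)) \<longlonglongrightarrow> abs_ptensor X"
proof (rule LIMSEQ_I)
  fix e :: real assume "e > 0"
  then have "e/2 > 0" by simp
  then obtain N where N: "\<And>m n. m \<ge> N \<Longrightarrow> n \<ge> N \<Longrightarrow> gamma_norm (X m - X n) < e/2"
    using X unfolding gamma_Cauchy_def by blast
  have "norm (ptensor_of (X n) - abs_ptensor X) < e" if n: "n \<ge> N" for n
  proof -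
    have C: "gamma_Cauchy (\<lambda>m. X m + (-1) *\<^sub>C X n)"
      by (intro gamma_Cauchy_add X gamma_Cauchy_const)
    have "abs_ptensor X - ptensor_of (X n) = abs_ptensor (\<lambda>m. X m + (-1) *\<^sub>C X n)"
      by (simp add: minus_ptensor_def uminus_ptensor_def ptensor_of_def scaleC_ptensor.abs_eq
          plus_ptensor.abs_eq gamma_equiv_refl X gamma_Cauchy_const)
    then have "(\<lambda>m. gamma_norm (X m + (-1) *\<^sub>C X n)) \<longlonglongrightarrow> norm (abs_ptensor X - ptensor_of (X n))"
      using norm_ptensor_tendsto[OF C] by simp
    then have "norm (abs_ptensor X - ptensor_of (X n)) \<le> e/2"
      by (rule LIMSEQ_le_const2) (use N n in \<open>auto simp: scaleC_minus1 intro!: exI[of _ N] less_imp_le\<close>)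
    then show ?thesis
      using \<open>e > 0\<close> by (simp add: norm_minus_commute)
  qed
  then show "\<exists>N. \<forall>n\<ge>N. norm (ptensor_of (X n) - abs_ptensor X) < e"
    by blast
qed

lemma ptensor_of_dense:
  assumes "e > 0"
  shows "\<exists>t. norm (u - ptensor_of t) < e"
proof -
  obtain X where X: "u = abs_ptensor X" "gamma_Cauchy X"
    by (rule ptensor_cases)
  then obtain n where "norm (ptensor_of (X n) - u) < e"
    using LIMSEQ_D[OF ptensor_of_tendsto[OF X(2)] assms] by auto
  then show ?thesis
    by (auto simp: norm_minus_commute)
qed

instance ptensor :: (complex_normed_vector, complex_normed_vector) complex_banach
proof
  fix Z :: "nat \<Rightarrow> ('a, 'b) ptensor"
  assume Z: "Cauchy Z"
  have "\<exists>t. norm (Z n - ptensor_of t) < inverse (real (Suc n))" for n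
    by (rule ptensor_of_dense) simp
  then obtain X where X: "\<And>n. norm (Z n - ptensor_of (X n)) < inverse (real (Suc n))"
    by metis
  have "(\<lambda>n. Z n - ptensor_of (X n)) \<longlonglongrightarrow> 0"
    by (rule Lim_null_comparison[OF _ LIMSEQ_inverse_real_of_nat]) (intro always_eventually allI less_imp_le X)
  then have diff: "(\<lambda>n. ptensor_of (X n) - Z n) \<longlonglongrightarrow> 0"
    using tendsto_minus by fastforce
  have "Cauchy (\<lambda>n. ptensor_of (X n))"
  proof (rule CauchyI)
    fix e :: real assume "e > 0"
    then have e: "e/3 > 0" by simp
    obtain M where M: "\<And>n. n \<ge> M \<Longrightarrow> norm (ptensor_of (X n) - Z n) < e/3"
      using LIMSEQ_D[OF diff e] by auto
    obtain N where N: "\<And>m n. m \<ge> N \<Longrightarrow> n \<ge> N \<Longrightarrow> norm (Z m - Z n) < e/3"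
      using CauchyD[OF Z e] by blast
    have "norm (ptensor_of (X m) - ptensor_of (X n)) < e" if "m \<ge> max M N" "n \<ge> max M N" for m n
    proof -
      have "norm (ptensor_of (X m) - ptensor_of (X n))
          \<le> norm (ptensor_of (X m) - Z m) + norm (Z m - Z n) + norm (ptensor_of (X n) - Z n)"
        using norm_triangle_ineq[of "ptensor_of (X m) - Z m" "Z m - Z n"]
          norm_triangle_ineq4[of "ptensor_of (X m) - Z n" "ptensor_of (X n) - Z n"] by simp
      then show ?thesis
        using M[of m] M[of n] N[of m n] that by simp
    qed
    then show "\<exists>N. \<forall>m\<ge>N. \<forall>n\<ge>N. norm (ptensor_of (X m) - ptensor_of (X n)) < e"
      by blast
  qed
  then have C: "gamma_Cauchy X"
    unfolding Cauchy_def gamma_Cauchy_def dist_norm by (simp add: norm_ptensor_of flip: ptensor_of_diff)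
  have "(\<lambda>n. ptensor_of (X n) - (ptensor_of (X n) - Z n)) \<longlonglongrightarrow> abs_ptensor X - 0"
    by (intro tendsto_diff ptensor_of_tendsto C diff)
  then show "convergent Z"
    by (auto simp: convergent_def)
qed

instantiation ptensor :: (complex_normed_algebra, complex_normed_algebra) complex_banach_algebra
begin

lift_definition times_ptensor :: "('a, 'b) ptensor \<Rightarrow> ('a, 'b) ptensor \<Rightarrow> ('a, 'b) ptensor"
  is "\<lambda>X Y n. X n * Y n" by (rule gamma_equiv_mult)

instance
proof
  fix u v w :: "('a, 'b) ptensor" and a :: complex and r :: real
  show "u * v * w = u * (v * w)" "(u + v) * w = u * w + v * w" "u * (v + w) = u * v + u * w"
    by (transfer, simp add: algebra_simps gamma_equiv_def gamma_Cauchy_mult gamma_Cauchy_add)+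
  show left: "(a *\<^sub>C u) * v = a *\<^sub>C (u * v)" for a
    by (transfer, simp add: mult_scaleC_left gamma_equiv_def gamma_Cauchy_mult gamma_Cauchy_scaleC)
  show right: "u * (a *\<^sub>C v) = a *\<^sub>C (u * v)" for a
    by (transfer, simp add: mult_scaleC_right gamma_equiv_def gamma_Cauchy_mult gamma_Cauchy_scaleC)
  show "(r *\<^sub>R u) * v = r *\<^sub>R (u * v)" "u * (r *\<^sub>R v) = r *\<^sub>R (u * v)"
    by (simp_all add: left right flip: scaleC_of_real)
  obtain X where X: "u = abs_ptensor X" "gamma_Cauchy X"
    by (rule ptensor_cases)
  obtain Y where Y: "v = abs_ptensor Y" "gamma_Cauchy Y"
    by (rule ptensor_cases)
  show "norm (u * v) \<le> norm u * norm v"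
  proof (rule LIMSEQ_le)
    show "(\<lambda>n. gamma_norm (X n * Y n)) \<longlonglongrightarrow> norm (u * v)"
      using norm_ptensor_tendsto[OF gamma_Cauchy_mult[OF X(2) Y(2)]]
      by (simp add: X Y times_ptensor.abs_eq gamma_equiv_refl)
    show "(\<lambda>n. gamma_norm (X n) * gamma_norm (Y n)) \<longlonglongrightarrow> norm u * norm v"
      unfolding X(1) Y(1) by (intro tendsto_mult norm_ptensor_tendsto X Y)
  qed (auto intro: gamma_mult_le)
qed

end

lemma ptensor_of_mult: "ptensor_of (u * v) = ptensor_of u * ptensor_of v"
  by (simp add: ptensor_of_def times_ptensor.abs_eq gamma_equiv_refl gamma_Cauchy_const)


section \<open>Arens regularity\<close>

text \<open>Functionals on the dual are represented by functions on all maps \<open>'a \<Rightarrow> complex\<close>, of which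
  only the values on the dual matter.\<close>

definition dual :: "('a::complex_normed_vector \<Rightarrow> complex) set"
  where "dual = {\<omega>. bounded_clinear \<omega>}"

definition bidual :: "(('a::complex_normed_vector \<Rightarrow> complex) \<Rightarrow> complex) set"
  where "bidual = {f.
    (\<forall>\<omega>\<in>dual. \<forall>\<eta>\<in>dual. f (\<lambda>a. \<omega> a + \<eta> a) = f \<omega> + f \<eta>) \<and>
    (\<forall>c. \<forall>\<omega>\<in>dual. f (\<lambda>a. c * \<omega> a) = c * f \<omega>) \<and>
    (\<exists>K. \<forall>\<omega>\<in>dual. cmod (f \<omega>) \<le> K * onorm \<omega>)}"

text \<open>For a functional \<open>\<omega>\<close> on \<open>A\<close>, an element \<open>a\<close> of \<open>A\<close> and \<open>f\<close> in the bidual, these are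
  \<open>\<omega>\<^sub>a\<close>, \<open>\<^sub>a\<omega>\<close>, \<open>\<omega>\<^sub>f\<close> and \<open>\<^sub>f\<omega>\<close>, in this order.\<close>

definition elem_right :: "('a::complex_normed_algebra \<Rightarrow> complex) \<Rightarrow> 'a \<Rightarrow> 'a \<Rightarrow> complex"
  where "elem_right \<omega> a = (\<lambda>b. \<omega> (a * b))"

definition elem_left :: "'a::complex_normed_algebra \<Rightarrow> ('a \<Rightarrow> complex) \<Rightarrow> 'a \<Rightarrow> complex"
  where "elem_left a \<omega> = (\<lambda>b. \<omega> (b * a))"

definition bidual_right ::
    "('a::complex_normed_algebra \<Rightarrow> complex) \<Rightarrow> (('a \<Rightarrow> complex) \<Rightarrow> complex) \<Rightarrow> 'a \<Rightarrow> complex"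
  where "bidual_right \<omega> f = (\<lambda>a. f (elem_left a \<omega>))"

definition bidual_left ::
    "(('a::complex_normed_algebra \<Rightarrow> complex) \<Rightarrow> complex) \<Rightarrow> ('a \<Rightarrow> complex) \<Rightarrow> 'a \<Rightarrow> complex"
  where "bidual_left f \<omega> = (\<lambda>a. f (elem_right \<omega> a))"

definition arens_box ::
    "(('a::complex_normed_algebra \<Rightarrow> complex) \<Rightarrow> complex) \<Rightarrow> (('a \<Rightarrow> complex) \<Rightarrow> complex)
      \<Rightarrow> ('a \<Rightarrow> complex) \<Rightarrow> complex"
  where "arens_box f g = (\<lambda>\<omega>. f (bidual_left g \<omega>))"

definition arens_diamond ::
    "(('a::complex_normed_algebra \<Rightarrow> complex) \<Rightarrow> complex) \<Rightarrow> (('a \<Rightarrow> complex) \<Rightarrow> complex)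
      \<Rightarrow> ('a \<Rightarrow> complex) \<Rightarrow> complex"
  where "arens_diamond f g = (\<lambda>\<omega>. g (bidual_right \<omega> f))"

definition arens_regular :: "'a::complex_normed_algebra itself \<Rightarrow> bool"
  where "arens_regular _ \<longleftrightarrow>
    (\<forall>f\<in>bidual. \<forall>g\<in>bidual. \<forall>\<omega>\<in>(dual :: ('a \<Rightarrow> complex) set). arens_box f g \<omega> = arens_diamond f g \<omega>)"

definition infinite_dimensional :: "'a::complex_vector itself \<Rightarrow> bool"
  where "infinite_dimensional _ \<longleftrightarrow>
    \<not> (\<exists>B :: 'a set. finite B \<and> (\<forall>x. \<exists>c. x = (\<Sum>b\<in>B. c b *\<^sub>C b)))"

end

theory Submission
  imports Defs
begin

text \<open>Let \<open>e\<^sub>i\<^sub>j\<close> be the matrix units of an orthonormal sequence of \<open>\<H>\<close>; they are orthonormal in \<open>\<K>\<close>.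
  Let \<open>a\<^sub>i\<close> be the finite rank partial isometry of \<open>\<K>\<close> with \<open>a\<^sub>i e\<^sub>0\<^sub>j = e\<^sub>i\<^sub>j\<close> for \<open>j \<le> i\<close>
  and \<open>a\<^sub>i = 0\<close> elsewhere, and let \<open>a'\<^sub>j\<close> be the rank one operator mapping \<open>e\<^sub>0\<^sub>0\<close> to \<open>e\<^sub>0\<^sub>j\<close>. The
  products of the bounded sequences \<open>x\<^sub>i = a\<^sub>i \<otimes> e\<^sub>i\<^sub>0\<close> and \<open>y\<^sub>j = a'\<^sub>j \<otimes> e\<^sub>0\<^sub>j\<close> are
  \<open>a\<^sub>i a'\<^sub>j \<otimes> e\<^sub>i\<^sub>j\<close>. The bounded bilinear form
  \<open>m a b = \<Sum>\<^sub>k\<^sub>l \<langle>a e\<^sub>0\<^sub>0, e\<^sub>k\<^sub>l\<rangle> \<langle>b, e\<^sub>k\<^sub>l\<rangle>\<close> takes the value \<open>1\<close> on \<open>x\<^sub>i y\<^sub>j\<close> if \<open>j \<le> i\<close> and \<open>0\<close>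
  otherwise, so its two iterated limits differ. Limits along an ultrafilter turn the two
  sequences into elements of the bidual on which the two Arens products differ.\<close>

section \<open>The iterated limit criterion\<close>

text \<open>The minimal proper filters are the ultrafilters.\<close>

lemma minimal_filter_exists:
  fixes F :: "'a filter"
  assumes "F \<noteq> bot"
  obtains U where "U \<le> F" "U \<noteq> bot" "\<And>G. G \<le> U \<Longrightarrow> G \<noteq> bot \<Longrightarrow> G = U"
proof -
  define A where "A = {G. G \<le> F \<and> G \<noteq> bot}"
  have "\<exists>U\<in>A. \<forall>G\<in>A. U \<ge> G \<longrightarrow> G = U"
  proof (rule predicate_Zorn)
    show "partial_order_on A (relation_of (\<ge>) A)"
      by (auto simp: partial_order_on_def preorder_on_def refl_on_def trans_def antisym_def relation_of_def)
    fix C assume C: "C \<in> Chains (relation_of (\<ge>) A)"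
    show "\<exists>u\<in>A. \<forall>a\<in>C. a \<ge> u"
    proof (cases "C = {}")
      case True
      then show ?thesis
        using assms by (auto simp: A_def)
    next
      case False
      have CA: "C \<subseteq> A" and chain: "\<And>G H. G \<in> C \<Longrightarrow> H \<in> C \<Longrightarrow> G \<le> H \<or> H \<le> G"
        using C by (auto simp: Chains_def relation_of_def)
      \<comment> \<open>By \<open>Inf_filter_not_bot\<close> finite infima suffice: in a chain a
        nonempty finite one is a member, and the empty one is \<open>top\<close>, which lies above
        \<open>F\<close>.\<close>
      have "Inf X \<noteq> bot" if X: "X \<subseteq> C" "finite X" for X
      proof (cases "X = {}")
        case True
        then have "F \<le> Inf X"
          by simp
        then show ?thesis
          using assms bot.extremum_uniqueI by metis
      next
        case False
        have "Inf X \<in> X"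
          using X(2) False X(1)
        proof (induction rule: finite_ne_induct)
          case (insert G X)
          then have "G \<le> Inf X \<or> Inf X \<le> G"
            using chain by blast
          then show ?case
            using insert by (auto simp: inf_absorb1 inf_absorb2)
        qed simp
        then show ?thesis
          using X CA by (auto simp: A_def)
      qed
      then have "Inf C \<noteq> bot"
        by (rule Inf_filter_not_bot)
      moreover obtain G where "G \<in> C"
        using False by blast
      moreover from this have "Inf C \<le> F"
        using CA by (auto simp: A_def intro: Inf_lower2)
      ultimately show ?thesis
        by (intro bexI[of _ "Inf C"]) (auto simp: A_def Inf_lower)
    qed
  qed
  then obtain U where U: "U \<in> A" and "\<And>G. G \<in> A \<Longrightarrow> G \<le> U \<Longrightarrow> G = U"
    by blast
  then show ?thesis
    using that[of U] by (auto simp: A_def intro: order_trans)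
qed

text \<open>Compactness gives a cluster point of the image of \<open>U\<close>. Refining
  \<open>U\<close> by the preimages of its neighbourhoods leaves a proper filter; by minimality this
  is \<open>U\<close> itself, so the cluster point is a limit.\<close>

lemma minimal_filter_tendsto:
  fixes s :: "'a \<Rightarrow> 'b::heine_borel"
  assumes min: "\<And>G. G \<le> U \<Longrightarrow> G \<noteq> bot \<Longrightarrow> G = U" and U: "U \<noteq> bot" and s: "bounded (range s)"
  obtains l where "(s \<longlongrightarrow> l) U"
proof -
  have ev: "\<forall>\<^sub>F y in filtermap s U. y \<in> closure (range s)"
    by (simp add: eventually_filtermap closure_subset[THEN subsetD])
  have neq: "filtermap s U \<noteq> bot"
    using U by (simp add: filtermap_bot_iff)
  have "compact (closure (range s))"
    using s by simp
  from this[unfolded compact_filter, rule_format, OF neq ev]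
  obtain l where l: "inf (nhds l) (filtermap s U) \<noteq> bot" ..
  have "inf (filtercomap s (nhds l)) U \<noteq> bot"
  proof
    assume "inf (filtercomap s (nhds l)) U = bot"
    then obtain P Q where P: "eventually P (nhds l)" and Q: "eventually Q U"
      and PQ: "\<And>x. P (s x) \<Longrightarrow> Q x \<Longrightarrow> False"
      unfolding trivial_limit_def eventually_inf eventually_filtercomap by blast
    have "eventually (\<lambda>x. \<not> P (s x)) U"
      by (rule eventually_mono[OF Q]) (use PQ in blast)
    then have "eventually (\<lambda>y. \<not> P y) (filtermap s U)"
      by (simp add: eventually_filtermap)
    with P have "eventually (\<lambda>y. False) (inf (nhds l) (filtermap s U))"
      unfolding eventually_inf by blast
    with l show False
      by (simp add: trivial_limit_def)
  qed
  then have "inf (filtercomap s (nhds l)) U = U"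
    by (rule min[rotated]) simp
  then have "U \<le> filtercomap s (nhds l)"
    by (metis inf_le1)
  then show ?thesis
    using that by (simp add: filterlim_iff_le_filtercomap)
qed

text \<open>This is a weak-star limit of the evaluations at \<open>x n\<close>. \<open>Lim\<close>
  is unspecified where no limit exists; on the dual, boundedness and minimality provide one, and
  \<open>bidual\<close> constrains only the values there.\<close>

lemma bidual_limit:
  fixes x :: "nat \<Rightarrow> 'a::complex_normed_vector"
  assumes min: "\<And>G. G \<le> U \<Longrightarrow> G \<noteq> bot \<Longrightarrow> G = U" and U: "U \<noteq> bot" and x: "\<And>n. norm (x n) \<le> B"
  shows "(\<lambda>\<omega>. Lim U (\<lambda>n. \<omega> (x n))) \<in> bidual"
proof -
  have le: "cmod (\<omega> (x n)) \<le> B * onorm \<omega>" if "\<omega> \<in> dual" for \<omega> n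
  proof -
    have "bounded_linear \<omega>"
      using that by (simp add: dual_def bounded_clinear_bounded_linear)
    then have "cmod (\<omega> (x n)) \<le> onorm \<omega> * norm (x n)" "0 \<le> onorm \<omega>"
      by (auto intro: onorm onorm_pos_le)
    then show ?thesis
      using mult_left_mono[OF x[of n], of "onorm \<omega>"] by (simp add: mult.commute)
  qed
  have tends: "((\<lambda>n. \<omega> (x n)) \<longlongrightarrow> Lim U (\<lambda>n. \<omega> (x n))) U" if "\<omega> \<in> dual" for \<omega>
  proof -
    have "bounded (range (\<lambda>n. \<omega> (x n)))"
      using le[OF that] by (auto simp: bounded_iff)
    then obtain l where "((\<lambda>n. \<omega> (x n)) \<longlongrightarrow> l) U"
      using minimal_filter_tendsto[OF min U] by blast
    then show ?thesis
      using tendsto_Lim[OF U] by blast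
  qed
  show ?thesis
    unfolding bidual_def
  proof (intro CollectI conjI ballI allI exI[of _ B])
    fix \<omega> \<eta> :: "'a \<Rightarrow> complex" and c :: complex
    assume \<omega>: "\<omega> \<in> dual"
    show "Lim U (\<lambda>n. c * \<omega> (x n)) = c * Lim U (\<lambda>n. \<omega> (x n))"
      by (intro tendsto_Lim U tendsto_mult_left tends \<omega>)
    show "cmod (Lim U (\<lambda>n. \<omega> (x n))) \<le> B * onorm \<omega>"
      by (rule tendsto_upperbound[OF tendsto_norm[OF tends[OF \<omega>]]]) (auto simp: le \<omega> U)
    assume \<eta>: "\<eta> \<in> dual"
    show "Lim U (\<lambda>n. \<omega> (x n) + \<eta> (x n)) = Lim U (\<lambda>n. \<omega> (x n)) + Lim U (\<lambda>n. \<eta> (x n))"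
      by (intro tendsto_Lim U tendsto_add tends \<omega> \<eta>)
  qed
qed

text \<open>Let \<open>f\<close> and \<open>g\<close> be the limits of the evaluations at
  \<open>x i\<close> and \<open>y j\<close> along one ultrafilter. At \<open>\<omega>\<close> the
  box product takes the limit in \<open>j\<close> first, the diamond product the limit in
  \<open>i\<close>. An ultrafilter finer than \<open>sequentially\<close> preserves the given
  limits, so the two values are \<open>P\<close> and \<open>Q\<close>.\<close>

lemma not_arens_regularI:
  fixes x y :: "nat \<Rightarrow> 'a::complex_normed_algebra" and \<omega> :: "'a \<Rightarrow> complex"
  assumes \<omega>: "bounded_clinear \<omega>" and x: "\<And>n. norm (x n) \<le> B" and y: "\<And>n. norm (y n) \<le> C"
    and p: "\<And>i. (\<lambda>j. \<omega> (x i * y j)) \<longlonglongrightarrow> p i" "p \<longlonglongrightarrow> P"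
    and q: "\<And>j. (\<lambda>i. \<omega> (x i * y j)) \<longlonglongrightarrow> q j" "q \<longlonglongrightarrow> Q"
    and "P \<noteq> Q"
  shows "\<not> arens_regular TYPE('a)"
proof
  assume reg: "arens_regular TYPE('a)"
  obtain U :: "nat filter" where U: "U \<le> sequentially" "U \<noteq> bot"
    and min: "\<And>G. G \<le> U \<Longrightarrow> G \<noteq> bot \<Longrightarrow> G = U"
    using minimal_filter_exists[OF sequentially_bot] by blast
  have Lim: "Lim U s = l" if "s \<longlonglongrightarrow> l" for s and l :: complex
    using tendsto_Lim[OF U(2) filterlim_mono[OF that order_refl U(1)]] .
  define f where "f = (\<lambda>\<omega>. Lim U (\<lambda>n. \<omega> (x n) :: complex))"
  define g where "g = (\<lambda>\<omega>. Lim U (\<lambda>n. \<omega> (y n) :: complex))"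
  have "f \<in> bidual" "g \<in> bidual"
    unfolding f_def g_def using bidual_limit[OF min U(2)] x y by blast+
  then have "arens_box f g \<omega> = arens_diamond f g \<omega>"
    using reg \<omega> by (simp add: arens_regular_def dual_def)
  moreover have "arens_box f g \<omega> = P"
    by (simp add: arens_box_def bidual_left_def elem_right_def f_def g_def Lim[OF p(1)] Lim[OF p(2)])
  moreover have "arens_diamond f g \<omega> = Q"
    by (simp add: arens_diamond_def bidual_right_def elem_left_def f_def g_def Lim[OF q(1)] Lim[OF q(2)])
  ultimately show False
    using \<open>P \<noteq> Q\<close> by simp
qed

section \<open>Bounded bilinear forms on projective tensor products\<close>

locale bounded_bilinear_form =
  fixes m :: "'a::complex_normed_vector \<Rightarrow> 'b::complex_normed_vector \<Rightarrow> complex" and K :: real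
  assumes add_left: "m (x + x') y = m x y + m x' y"
    and add_right: "m x (y + y') = m x y + m x y'"
    and scale_left: "m (c *\<^sub>C x) y = c * m x y"
    and scale_right: "m x (c *\<^sub>C y) = c * m x y"
    and bound: "cmod (m x y) \<le> K * (norm x * norm y)"
    and nonneg: "0 \<le> K"
begin

lemma zero_left: "m 0 y = 0"
  using scale_left[of 0 0 y] by simp

text \<open>The generators of the congruence are instances of bilinearity, which \<open>m\<close>
  respects, so the sum descends to the quotient.\<close>

lemma tensor_eq_imp_sum_eq:
  "tensor_eq M N \<Longrightarrow> (\<Sum>(x, y)\<in>#M. m x y) = (\<Sum>(x, y)\<in>#N. m x y)"
  by (induction rule: tensor_eq.induct)
    (auto simp: add_left add_right scale_left scale_right zero_left)

definition tensor_form :: "('a, 'b) tensor \<Rightarrow> complex"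
  where "tensor_form u = (\<Sum>(x, y)\<in>#rep_tensor u. m x y)"

lemma tensor_form_abs: "tensor_form (abs_tensor M) = (\<Sum>(x, y)\<in>#M. m x y)"
  unfolding tensor_form_def
  by (rule tensor_eq_imp_sum_eq) (rule Quotient_rep_abs[OF Quotient_tensor tensor_eq.refl])

lemma tensor_form_tens [simp]: "tensor_form (x \<otimes> y) = m x y"
  by (simp add: tens.abs_eq tensor_form_abs)

lemma tensor_form_zero [simp]: "tensor_form 0 = 0"
  by (simp add: zero_tensor_def tensor_form_abs)

lemma tensor_form_add [simp]: "tensor_form (u + v) = tensor_form u + tensor_form v"
  by (induction u rule: tensor.abs_induct, induction v rule: tensor.abs_induct)
    (simp add: plus_tensor.abs_eq tensor_form_abs)

lemma tensor_form_scaleC [simp]: "tensor_form (c *\<^sub>C u) = c * tensor_form u"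
  by (induction u rule: tensor_induct)
    (simp_all add: scaleC_add_right scale_left distrib_left flip: tens_scaleC_left)

lemma tensor_form_diff: "tensor_form (u - v) = tensor_form u - tensor_form v"
  using tensor_form_add[of "u - v" v] by simp

lemma tensor_form_bound: "cmod (tensor_form u) \<le> K * gamma_norm u"
proof (rule field_le_epsilon)
  fix e :: real assume "e > 0"
  \<comment> \<open>The slack is divided by \<open>K + 1\<close> because \<open>K\<close> may be
    \<open>0\<close>.\<close>
  then have e: "e / (K + 1) > 0"
    using nonneg by simp
  obtain M where M: "u = (\<Sum>(x, y)\<in>#M. x \<otimes> y)"
    "(\<Sum>(x, y)\<in>#M. norm x * norm y) < gamma_norm u + e / (K + 1)"
    using gamma_approx[OF e] .
  have "cmod (tensor_form (\<Sum>(x, y)\<in>#M. x \<otimes> y)) \<le> K * (\<Sum>(x, y)\<in>#M. norm x * norm y)"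
    by (induction M) (auto simp: distrib_left intro!: order_trans[OF norm_triangle_ineq add_mono[OF bound]])
  also have "\<dots> \<le> K * (gamma_norm u + e / (K + 1))"
    using M(2) nonneg by (intro mult_left_mono) auto
  also have "\<dots> = K * gamma_norm u + K / (K + 1) * e"
    by (simp add: algebra_simps)
  also have "\<dots> \<le> K * gamma_norm u + 1 * e"
    using \<open>e > 0\<close> nonneg by (intro add_left_mono mult_right_mono) auto
  finally show "cmod (tensor_form u) \<le> K * gamma_norm u + e"
    using M(1) by simp
qed

text \<open>The extension by continuity, read off one chosen Cauchy sequence;
  \<open>ptensor_form_tendsto\<close> shows that every representing sequence gives the same
  value.\<close>

definition ptensor_form :: "('a, 'b) ptensor \<Rightarrow> complex"
  where "ptensor_form U = lim (\<lambda>n. tensor_form (rep_ptensor U n))"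

lemma tensor_form_convergent:
  assumes "gamma_Cauchy X"
  shows "convergent (\<lambda>n. tensor_form (X n))"
proof (rule Cauchy_convergent, rule CauchyI)
  fix e :: real assume "e > 0"
  then have "e / (K + 1) > 0"
    using nonneg by simp
  then obtain N where N: "\<forall>i\<ge>N. \<forall>j\<ge>N. gamma_norm (X i - X j) < e / (K + 1)"
    using assms unfolding gamma_Cauchy_def by blast
  have "cmod (tensor_form (X i) - tensor_form (X j)) < e" if "i \<ge> N" "j \<ge> N" for i j
  proof -
    have "cmod (tensor_form (X i) - tensor_form (X j)) \<le> K * gamma_norm (X i - X j)"
      using tensor_form_bound[of "X i - X j"] by (simp add: tensor_form_diff)
    also have "\<dots> \<le> (K + 1) * gamma_norm (X i - X j)"
      by (intro mult_right_mono gamma_nonneg) simp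
    also have "\<dots> < e"
      using N that nonneg by (auto simp: pos_less_divide_eq mult.commute)
    finally show ?thesis .
  qed
  then show "\<exists>N. \<forall>i\<ge>N. \<forall>j\<ge>N. cmod (tensor_form (X i) - tensor_form (X j)) < e"
    by blast
qed

lemma ptensor_form_tendsto:
  assumes X: "gamma_Cauchy X"
  shows "(\<lambda>n. tensor_form (X n)) \<longlonglongrightarrow> ptensor_form (abs_ptensor X)"
proof -
  let ?Y = "rep_ptensor (abs_ptensor X)"
  have eq: "gamma_equiv ?Y X"
    using X by (intro Quotient_rep_abs[OF Quotient_ptensor]) (simp add: gamma_equiv_refl)
  then have "(\<lambda>n. tensor_form (?Y n)) \<longlonglongrightarrow> ptensor_form (abs_ptensor X)"
    using tensor_form_convergent[of ?Y]
    by (simp add: ptensor_form_def gamma_equiv_def convergent_LIMSEQ_iff)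
  \<comment> \<open>Two representatives differ by a null sequence for \<open>gamma_norm\<close>, and
    \<open>tensor_form_bound\<close> carries this over to the values.\<close>
  moreover have "(\<lambda>n. tensor_form (?Y n) - tensor_form (X n)) \<longlonglongrightarrow> 0"
  proof (rule Lim_null_comparison)
    show "\<forall>\<^sub>F n in sequentially. cmod (tensor_form (?Y n) - tensor_form (X n))
        \<le> K * gamma_norm (?Y n - X n)"
      using tensor_form_bound by (simp flip: tensor_form_diff)
    show "(\<lambda>n. K * gamma_norm (?Y n - X n)) \<longlonglongrightarrow> 0"
      using eq by (intro tendsto_mult_right_zero) (simp add: gamma_equiv_def)
  qed
  ultimately show ?thesis
    using tendsto_diff by fastforce
qed

lemma ptensor_form_ptensor_of [simp]: "ptensor_form (ptensor_of u) = tensor_form u"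
  using LIMSEQ_unique[OF ptensor_form_tendsto[OF gamma_Cauchy_const] tendsto_const]
  by (simp add: ptensor_of_def)

lemma bounded_clinear_ptensor_form: "bounded_clinear ptensor_form"
proof (rule bounded_clinearI)
  fix u v :: "('a, 'b) ptensor" and c
  obtain X where X: "u = abs_ptensor X" "gamma_Cauchy X"
    by (rule ptensor_cases)
  obtain Y where Y: "v = abs_ptensor Y" "gamma_Cauchy Y"
    by (rule ptensor_cases)
  have "(\<lambda>n. tensor_form (X n) + tensor_form (Y n)) \<longlonglongrightarrow> ptensor_form (u + v)"
    using ptensor_form_tendsto[OF gamma_Cauchy_add[OF X(2) Y(2)]] X Y
    by (simp add: plus_ptensor.abs_eq gamma_equiv_refl)
  moreover have "(\<lambda>n. tensor_form (X n) + tensor_form (Y n)) \<longlonglongrightarrow> ptensor_form u + ptensor_form v"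
    unfolding X(1) Y(1) by (intro tendsto_add ptensor_form_tendsto X Y)
  ultimately show "ptensor_form (u + v) = ptensor_form u + ptensor_form v"
    by (rule LIMSEQ_unique)
  have "(\<lambda>n. c * tensor_form (X n)) \<longlonglongrightarrow> ptensor_form (c *\<^sub>C u)"
    using ptensor_form_tendsto[OF gamma_Cauchy_scaleC[OF X(2)]] X
    by (simp add: scaleC_ptensor.abs_eq gamma_equiv_refl)
  moreover have "(\<lambda>n. c * tensor_form (X n)) \<longlonglongrightarrow> c *\<^sub>C ptensor_form u"
    unfolding X(1) scaleC_complex_def by (intro tendsto_mult_left ptensor_form_tendsto X)
  ultimately show "ptensor_form (c *\<^sub>C u) = c *\<^sub>C ptensor_form u"
    by (rule LIMSEQ_unique)
  show "cmod (ptensor_form u) \<le> norm u * K"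
  proof (rule LIMSEQ_le)
    show "(\<lambda>n. cmod (tensor_form (X n))) \<longlonglongrightarrow> cmod (ptensor_form u)"
      unfolding X(1) by (intro tendsto_norm ptensor_form_tendsto X)
    show "(\<lambda>n. gamma_norm (X n) * K) \<longlonglongrightarrow> norm u * K"
      unfolding X(1) by (intro tendsto_mult_right norm_ptensor_tendsto X)
  qed (use tensor_form_bound in \<open>auto simp: mult.commute\<close>)
qed

end

section \<open>A bilinear form on a Hilbert space\<close>

text \<open>The inner product is sesquilinear; transposing along an orthonormal set makes it bilinear.\<close>

definition onb_form :: "'a::complex_inner set \<Rightarrow> 'a \<Rightarrow> 'a \<Rightarrow> complex"
  where "onb_form E x y = (\<Sum>\<^sub>\<infinity>e\<in>E. cinner x e * cinner y e)"

text \<open>Cauchy-Schwarz for the coefficients, then Bessel for both vectors. The bound is uniform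
  in \<open>F\<close>, so it yields both the absolute summability and the constant \<open>1\<close>
  of the form.\<close>

lemma onb_form_finite_le:
  assumes "orthonormal E" "finite F" "F \<subseteq> E"
  shows "(\<Sum>e\<in>F. cmod (cinner x e * cinner y e)) \<le> norm x * norm y"
proof -
  have F: "orthonormal F"
    using assms orthonormal_subset by blast
  have "(\<Sum>e\<in>F. cmod (cinner x e * cinner y e))
      \<le> L2_set (\<lambda>e. cmod (cinner x e)) F * L2_set (\<lambda>e. cmod (cinner y e)) F"
    using L2_set_mult_ineq[of "\<lambda>e. cmod (cinner x e)" "\<lambda>e. cmod (cinner y e)" F]
    by (simp add: norm_mult)
  also have "\<dots> \<le> norm x * norm y"
    unfolding L2_set_def
    by (intro mult_mono real_le_lsqrt) (use bessel[OF F assms(2)] in \<open>auto simp: sum_nonneg\<close>)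
  finally show ?thesis .
qed

lemma onb_form_abs_summable:
  assumes "orthonormal E"
  shows "(\<lambda>e. cmod (cinner x e * cinner y e)) summable_on E"
  by (rule nonneg_bdd_above_summable_on)
    (auto simp: bdd_above_def intro!: exI[of _ "norm x * norm y"] onb_form_finite_le[OF assms])

lemma onb_form_summable:
  "orthonormal E \<Longrightarrow> (\<lambda>e. cinner x e * cinner y e) summable_on E"
  by (rule abs_summable_summable) (rule onb_form_abs_summable)

lemma bounded_bilinear_form_onb_form:
  assumes E: "orthonormal E"
  shows "bounded_bilinear_form (onb_form E) 1"
proof
  note s = onb_form_summable[OF E]
  fix x x' y y' :: 'a and c
  show "onb_form E (x + x') y = onb_form E x y + onb_form E x' y"
    "onb_form E x (y + y') = onb_form E x y + onb_form E x y'"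
    by (simp_all add: onb_form_def cinner_add_left distrib_right distrib_left infsum_add s)
  show "onb_form E (c *\<^sub>C x) y = c * onb_form E x y"
    by (simp add: onb_form_def cinner_scaleC_left mult.assoc infsum_cmult_right')
  show "onb_form E x (c *\<^sub>C y) = c * onb_form E x y"
    by (simp add: onb_form_def cinner_scaleC_left mult.left_commute infsum_cmult_right')
  have "cmod (onb_form E x y) \<le> (\<Sum>\<^sub>\<infinity>e\<in>E. cmod (cinner x e * cinner y e))"
    unfolding onb_form_def by (rule norm_infsum_bound[OF onb_form_abs_summable[OF E]])
  also have "\<dots> \<le> norm x * norm y"
    by (rule infsum_le_finite_sums[OF onb_form_abs_summable[OF E]]) (rule onb_form_finite_le[OF E])
  finally show "cmod (onb_form E x y) \<le> 1 * (norm x * norm y)"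
    by simp
qed simp

lemma onb_form_self:
  assumes "orthonormal E" "e \<in> E"
  shows "onb_form E e e = 1"
proof -
  have "onb_form E e e = (\<Sum>\<^sub>\<infinity>f\<in>{e}. cinner e f * cinner e f)"
    unfolding onb_form_def
    by (rule infsum_cong_neutral) (use assms in \<open>auto simp: orthonormal_def\<close>)
  also have "\<dots> = 1"
    using assms by (simp add: orthonormal_def)
  finally show ?thesis .
qed

section \<open>Rank one operators\<close>

lemma norm_rank_one_le:
  "norm (cinner x v *\<^sub>C u) \<le> norm x * (norm u * norm (v :: 'a::complex_inner))"
  for u :: "'b::complex_normed_vector"
  using mult_right_mono[OF cinner_Cauchy_Schwarz[of x v] norm_ge_zero[of u]]
  by (simp add: norm_scaleC mult_ac)

lemma bounded_clinear_rank_one: "bounded_clinear (\<lambda>x. cinner x v *\<^sub>C u)"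
  by (rule bounded_clinearI[OF _ _ norm_rank_one_le])
    (auto simp: cinner_add_left cinner_scaleC_left scaleC_add_left scaleC_scaleC)

text \<open>At a basis vector the norm is a coefficient of \<open>v\<close> in absolute value times
  \<open>norm u\<close>, so Bessel applied to \<open>v\<close> bounds the square sums.\<close>

lemma is_hilbert_schmidt_rank_one: "is_hilbert_schmidt (\<lambda>x. cinner x v *\<^sub>C u)"
proof (rule hs_boundI(1)[OF bounded_clinear_rank_one])
  fix F :: "'a set" assume F: "finite F" "F \<subseteq> some_onb"
  then have "orthonormal F"
    using some_onb orthonormal_subset unfolding orthonormal_basis_def by blast
  moreover have "cmod (cinner e v) = cmod (cinner v e)" for e
    by (metis cinner_commute complex_mod_cnj)
  ultimately have "(\<Sum>e\<in>F. (cmod (cinner e v))\<^sup>2) \<le> (norm v)\<^sup>2"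
    using bessel[OF _ F(1), of v] by simp
  then show "(\<Sum>e\<in>F. (norm (cinner e v *\<^sub>C u))\<^sup>2) \<le> (norm v * norm u)\<^sup>2"
    by (auto simp: norm_scaleC power_mult_distrib mult_right_mono simp flip: sum_distrib_right)
qed simp

lemma is_compact_op_rank_one: "is_compact_op (\<lambda>x. cinner x v *\<^sub>C u)"
proof (rule compact_opI[OF bounded_clinear_rank_one])
  \<comment> \<open>The unit ball is mapped into the multiples of \<open>u\<close> by scalars from a
    compact disc.\<close>
  have "bounded_linear (\<lambda>c. c *\<^sub>C u)"
    by (rule bounded_linear_intro[where K = "norm u"])
      (auto simp: scaleC_add_left norm_scaleC scaleC_scaleC scaleR_conv_of_real simp flip: scaleC_of_real)
  then show "compact ((\<lambda>c. c *\<^sub>C u) ` cball 0 (norm v))"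
    by (intro compact_continuous_image linear_continuous_on) auto
  have "cmod (cinner x v) \<le> norm v" if "norm x \<le> 1" for x
    using cinner_Cauchy_Schwarz[of x v] mult_right_mono[OF that norm_ge_zero[of v]] by simp
  then show "(\<lambda>x. cinner x v *\<^sub>C u) ` cball 0 1 \<subseteq> (\<lambda>c. c *\<^sub>C u) ` cball 0 (norm v)"
    by auto
qed

lift_definition hs_rank_one :: "'a::chilbert_space \<Rightarrow> 'a \<Rightarrow> 'a hilbert_schmidt"
  is "\<lambda>u v x. cinner x v *\<^sub>C u" by (rule is_hilbert_schmidt_rank_one)

lift_definition compact_rank_one :: "'a::complex_inner \<Rightarrow> 'a \<Rightarrow> 'a compact_op"
  is "\<lambda>u v x. cinner x v *\<^sub>C u" by (rule is_compact_op_rank_one)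

lemma hs_rank_one_mult: "hs_rank_one u v * hs_rank_one u' v' = cinner u' v *\<^sub>C hs_rank_one u v'"
  by (rule hs_eqI)
    (simp add: times_hilbert_schmidt.rep_eq scaleC_hilbert_schmidt.rep_eq hs_rank_one.rep_eq
      cinner_scaleC_left scaleC_scaleC mult.commute)

text \<open>Expanding \<open>v'\<close> in the basis and pairing with \<open>v\<close> sums the
  trace. The order of \<open>v'\<close> and \<open>v\<close> is reversed because
  \<open>hs_rank_one\<close> is conjugate linear in its second argument.\<close>

lemma cinner_hs_rank_one:
  "cinner (hs_rank_one u v) (hs_rank_one u' v') = cinner u u' * cinner v' v"
proof -
  have "((\<lambda>e. cinner (cinner v' e *\<^sub>C e) v) has_sum cinner v' v) some_onb"
    using has_sum_bounded_linear[OF bounded_clinear_bounded_linear[OF bounded_clinear_cinner_left]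
        onb_expansion[OF some_onb]] .
  moreover have "cinner (cinner v' e *\<^sub>C e) v = cinner e v * cnj (cinner e v')" for e
    by (metis cinner_scaleC_left cinner_commute mult.commute)
  ultimately have "((\<lambda>e. cinner u u' * (cinner e v * cnj (cinner e v'))) has_sum cinner u u' * cinner v' v)
      some_onb"
    by (intro has_sum_cmult_right) simp
  then show ?thesis
    by (simp add: cinner_hs_eq hs_rank_one.rep_eq cinner_scaleC_left cinner_scaleC_right infsumI mult_ac)
qed

section \<open>Operators and orthonormal sequences for the counterexample\<close>

lemma norm_compact_op_le:
  assumes "\<And>x. norm (op_apply A x) \<le> norm x * C" "0 \<le> C"
  shows "norm A \<le> C"
  unfolding norm_compact_op.rep_eq
  by (rule onorm_bound) (use assms in \<open>auto simp: mult.commute\<close>)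

lemma op_apply_sum: "op_apply (sum f S) x = (\<Sum>i\<in>S. op_apply (f i) x)"
  by (induction S rule: infinite_finite_induct)
    (auto simp: zero_compact_op.rep_eq plus_compact_op.rep_eq)

text \<open>A finite \<open>some_onb\<close> would span the space, since the basis expansion would
  be a finite sum.\<close>

lemma orthonormal_sequence_exists:
  assumes "infinite_dimensional TYPE('h::chilbert_space)"
  shows "\<exists>u :: nat \<Rightarrow> 'h. \<forall>i j. cinner (u i) (u j) = (if i = j then 1 else 0)"
proof -
  have "infinite (some_onb :: 'h set)"
  proof
    assume fin: "finite (some_onb :: 'h set)"
    have "x = (\<Sum>e\<in>some_onb. cinner x e *\<^sub>C e)" for x :: 'h
      using onb_expansion[OF some_onb, of x] fin
      by (metis has_sum_finite has_sum_unique)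
    then show False
      using assms fin unfolding infinite_dimensional_def by blast
  qed
  then obtain u :: "nat \<Rightarrow> 'h" where "inj u" "range u \<subseteq> some_onb"
    using infinite_countable_subset by blast
  then show ?thesis
    using some_onb[where 'a = 'h]
    by (intro exI[of _ u]) (simp add: orthonormal_basis_def orthonormal_def inj_def range_subsetD)
qed

theorem corollary4p7:
  assumes "infinite_dimensional TYPE('h::chilbert_space)"
  shows "\<not> arens_regular TYPE(('h hilbert_schmidt compact_op, 'h hilbert_schmidt) ptensor)"
proof -
  obtain u :: "nat \<Rightarrow> 'h" where u: "\<And>i j. cinner (u i) (u j) = (if i = j then 1 else 0)"
    using orthonormal_sequence_exists[OF assms] by blast
  define e where "e i j = hs_rank_one (u i) (u j)" for i j
  have e: "cinner (e i j) (e k l) = (if i = k \<and> j = l then 1 else 0)" for i j k l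
    by (auto simp: e_def cinner_hs_rank_one u)
  have e_mult: "e i j * e j k = e i k" for i j k
    by (simp add: e_def hs_rank_one_mult u)
  define E where "E = range (\<lambda>(i, j). e i j)"
  have E: "orthonormal E"
    unfolding orthonormal_def
  proof (intro ballI)
    fix a b assume "a \<in> E" "b \<in> E"
    then obtain i j k l where ab: "a = e i j" "b = e k l"
      by (auto simp: E_def)
    \<comment> \<open>Distinct index pairs give orthogonal unit vectors, so a matrix unit determines
      its indices.\<close>
    have "i = k \<and> j = l" if "a = b"
      using that e[of i j i j] e[of i j k l] by (auto simp: ab split: if_splits)
    then show "cinner a b = (if a = b then 1 else 0)"
      by (auto simp: ab e)
  qed
  have eE: "e i j \<in> E" for i j
    by (auto simp: E_def)
  have ne: "norm (e i j) = 1" for i j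
    using orthonormal_norm[OF E eE] .
  define m where "m = (\<lambda>(a :: 'h hilbert_schmidt compact_op) b. onb_form E (op_apply a (e 0 0)) b)"
  interpret F: bounded_bilinear_form "onb_form E" 1
    using E by (rule bounded_bilinear_form_onb_form)
  interpret bounded_bilinear_form m 1
  proof
    fix a :: "'h hilbert_schmidt compact_op" and b
    have "cmod (m a b) \<le> norm (op_apply a (e 0 0)) * norm b"
      using F.bound by (simp add: m_def)
    also have "\<dots> \<le> norm a * norm b"
      using op_apply_norm[of a "e 0 0"] by (intro mult_right_mono) (auto simp: ne)
    finally show "cmod (m a b) \<le> 1 * (norm a * norm b)"
      by simp
  qed (simp_all add: m_def plus_compact_op.rep_eq scaleC_compact_op.rep_eq F.add_left F.add_right
      F.scale_left F.scale_right)
  define a where "a i = (\<Sum>j\<le>i. compact_rank_one (e i j) (e 0 j))" for i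
  define a' where "a' j = compact_rank_one (e 0 j) (e 0 0)" for j
  define x where "x i = ptensor_of (a i \<otimes> e i 0)" for i
  define y where "y j = ptensor_of (a' j \<otimes> e 0 j)" for j
  have a_apply: "op_apply (a i) z = (\<Sum>j\<le>i. cinner z (e 0 j) *\<^sub>C e i j)" for i z
    by (simp add: a_def op_apply_sum compact_rank_one.rep_eq)
  have "norm (a i) \<le> 1" for i
  proof (rule norm_compact_op_le)
    fix z
    \<comment> \<open>\<open>pythagoras\<close> and \<open>bessel\<close> speak of sets, so sums
      over indices are turned into sums over matrix units; \<open>c\<close> attaches to
      \<open>e i j\<close> the coefficient of \<open>z\<close> at \<open>e 0 j\<close>.\<close>
    have inj: "inj_on (e k) S" for k S
      by (rule inj_onI) (metis e zero_neq_one)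
    have on: "orthonormal (e k ` S)" for k S
      by (rule orthonormal_subset[OF E]) (auto simp: eE)
    define c where "c b = cinner z (e 0 (the_inv_into {..i} (e i) b))" for b
    have c: "c (e i j) = cinner z (e 0 j)" if "j \<le> i" for j
      using that by (simp add: c_def the_inv_into_f_f inj)
    \<comment> \<open>\<open>a i\<close> moves coefficients of \<open>z\<close> from row
      \<open>0\<close> to row \<open>i\<close>: Pythagoras in row \<open>i\<close> and Bessel in row
      \<open>0\<close> show that it is a contraction.\<close>
    have "(norm (op_apply (a i) z))\<^sup>2 = (norm (\<Sum>b\<in>e i ` {..i}. c b *\<^sub>C b))\<^sup>2"
      by (simp add: a_apply sum.reindex inj c)
    also have "\<dots> = (\<Sum>b\<in>e i ` {..i}. (cmod (c b))\<^sup>2)"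
      by (rule pythagoras[OF on]) simp
    also have "\<dots> = (\<Sum>b\<in>e 0 ` {..i}. (cmod (cinner z b))\<^sup>2)"
      by (simp add: sum.reindex inj c)
    also have "\<dots> \<le> (norm z)\<^sup>2"
      by (rule bessel[OF on]) simp
    finally have "norm (op_apply (a i) z) \<le> norm z"
      by (rule power2_le_imp_le) simp
    then show "norm (op_apply (a i) z) \<le> norm z * 1"
      by simp
  qed simp
  then have x_bound: "norm (x i) \<le> 1" for i
    using gamma_tens_le[of "a i" "e i 0"] by (simp add: x_def norm_ptensor_of ne order_trans)
  have "norm (a' j) \<le> 1" for j
    using norm_rank_one_le[of _ "e 0 0" "e 0 j"]
    by (intro norm_compact_op_le) (simp_all add: a'_def compact_rank_one.rep_eq ne)
  then have y_bound: "norm (y j) \<le> 1" for j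
    using gamma_tens_le[of "a' j" "e 0 j"] by (simp add: y_def norm_ptensor_of ne order_trans)
  have xy: "ptensor_form (x i * y j) = (if j \<le> i then 1 else 0)" for i j
  proof -
    \<comment> \<open>\<open>a' j\<close> sends \<open>e 0 0\<close> to \<open>e 0 j\<close>, so
      only the term \<open>k = j\<close> of \<open>a i\<close> survives, and it occurs exactly if
      \<open>j \<le> i\<close>.\<close>
    have "op_apply (a i * a' j) (e 0 0) = (\<Sum>k\<le>i. (if j = k then 1 else 0) *\<^sub>C e i k)"
      by (simp add: times_compact_op.rep_eq a_apply a'_def compact_rank_one.rep_eq e)
    also have "\<dots> = (\<Sum>k\<le>i. if j = k then e i k else 0)"
      by (intro sum.cong) auto
    also have "\<dots> = (if j \<le> i then e i j else 0)"
      by simp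
    finally have "op_apply (a i * a' j) (e 0 0) = (if j \<le> i then e i j else 0)" .
    moreover have "ptensor_form (x i * y j) = m (a i * a' j) (e i j)"
      by (simp add: x_def y_def tens_mult e_mult flip: ptensor_of_mult)
    ultimately show ?thesis
      by (simp add: m_def onb_form_self[OF E eE] F.zero_left)
  qed
  show ?thesis
  proof (rule not_arens_regularI[OF bounded_clinear_ptensor_form x_bound y_bound])
    \<comment> \<open>For fixed \<open>i\<close> the values vanish from \<open>j = Suc i\<close> on;
      for fixed \<open>j\<close> they are \<open>1\<close> from \<open>i = j\<close> on. The outer
      limits are then limits of constant sequences.\<close>
    show "(\<lambda>j. ptensor_form (x i * y j)) \<longlonglongrightarrow> 0" for i
      by (rule tendsto_eventually) (auto simp: xy eventually_sequentially intro: exI[of _ "Suc i"])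
    show "(\<lambda>i. ptensor_form (x i * y j)) \<longlonglongrightarrow> 1" for j
      by (rule tendsto_eventually) (auto simp: xy eventually_sequentially)
  qed auto
qed

end
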